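(* Let $\psi(x)=-2\pi\sin(2\pi x)$, $b\ge2$ an integer and $\gamma\in(1/b,1)$. Then: (1) if $b\ge6$, then $\sigma(1)\le e(1)<\gamma b$; (2) if $b\in\{4,5\}$, then either $e(1)=2$ or $e(1)<\gamma b$; (3) if $b=3$, then either $e(1)=2$ or $\sigma(1)<\gamma b$.
   Context: $\mathcal{A}=\{0,\dots,b-1\}$. $S(x,\mathbf{i})=\sum_{n\ge1}\gamma^{n-1}\psi\big(\frac{x+i_1+i_2b+\cdots+i_nb^{n-1}}{b^n}\big)$ for $\mathbf{i}\in\mathcal{A}^{\mathbb{Z}^+}$, $S'=\partial_xS$. For $\mathbf{u}\in\mathcal{A}^q$, $x(\mathbf{u})=(x+u_1+\cdots+u_qb^{q-1})/b^q$. Sequences $\mathbf{i},\mathbf{j}$ are $(\varepsilon,\delta)$-tangent at $x_0$ if $|S(x_0,\mathbf{i})-S(x_0,\mathbf{j})|\le\varepsilon$ and $|S'(x_0,\mathbf{i})-S'(x_0,\mathbf{j})|\le\delta$. $E(q,x_0;\varepsilon,\delta)$: pairs $(\mathbf{k},\mathbf{l})\in\mathcal{A}^q\times\mathcal{A}^q$ such that some concatenations $\mathbf{ku},\mathbf{lv}$ are $(\varepsilon,\delta)$-tangent at $x_0$. For $J\subset\mathbb{R}$: $E(q,J)=\bigcap_{\varepsilon,\delta>0}\bigcup_{x\in J}E(q,x;\varepsilon,\delta)$, $e(q,J)=\max_{\mathbf{k}}\#\{\mathbf{l}:(\mathbf{k},\mathbf{l})\in E(q,J)\}$, and $e(q)=\lim_{p\to\infty}\max_{0\le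 k<b^p}e(q,[k/b^p,(k+1)/b^p])$. Weight function: measurable $\omega:[0,1)\to(0,\infty)$ with $\omega,1/\omega$ bounded. Admissible testing function of order $q$: measurable $V:[0,1)\times\mathcal{A}^q\times\mathcal{A}^q\to[0,\infty)$ such that for some $\varepsilon,\delta>0$, $V(x,\mathbf{u},\mathbf{v})V(x,\mathbf{v},\mathbf{u})\ge1$ whenever $x\in[0,1)$ and $(\mathbf{u},\mathbf{v})\in E(q,x;\varepsilon,\delta)$. $\Sigma_{V,\omega}(x)=\sup_{\mathbf{u}}\frac{\omega(x)}{\omega(x(\mathbf{u}))}\sum_{\mathbf{v}}V(x,\mathbf{u},\mathbf{v})$; $\sigma(q)=\inf_{\omega,V}\|\Sigma_{V,\omega}\|_\infty$. *)

theory Defs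
  imports "HOL-Analysis.Analysis" "HOL-Probability.Essential_Supremum"
begin

definition psi :: "real \<Rightarrow> real" where
  "psi x = - 2 * pi * sin (2 * pi * x)"

(* Infinite sequences over the alphabet A = {0,...,b-1}.
   Convention: the paper's i_n (n >= 1) is  i (n-1)  here (0-based indexing). *)
definition digit_seq :: "nat \<Rightarrow> (nat \<Rightarrow> nat) \<Rightarrow> bool" where
  "digit_seq b i \<longleftrightarrow> (\<forall>n. i n < b)"

(* Finite words in A^q, as lists; u!0 is the paper's u_1. *)
definition words :: "nat \<Rightarrow> nat \<Rightarrow> nat list set" where
  "words b q = {w. length w = q \<and> set w \<subseteq> {..<b}}"

definition concat_seq :: "nat list \<Rightarrow> (nat \<Rightarrow> nat) \<Rightarrow> (nat \<Rightarrow> nat)" where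
  "concat_seq k u = (\<lambda>n. if n < length k then k ! n else u (n - length k))"

definition S :: "nat \<Rightarrow> real \<Rightarrow> real \<Rightarrow> (nat \<Rightarrow> nat) \<Rightarrow> real" where
  "S b \<gamma> x i = (\<Sum>n. \<gamma> ^ n * psi ((x + (\<Sum>k\<le>n. real (i k) * real b ^ k)) / real b ^ (Suc n)))"

definition S' :: "nat \<Rightarrow> real \<Rightarrow> real \<Rightarrow> (nat \<Rightarrow> nat) \<Rightarrow> real" where
  "S' b \<gamma> x i = deriv (\<lambda>y. S b \<gamma> y i) x"

definition xmap :: "nat \<Rightarrow> real \<Rightarrow> nat list \<Rightarrow> real" where
  "xmap b x u = (x + (\<Sum>k<length u. real (u ! k) * real b ^ k)) / real b ^ length u"

definition tangent :: "nat \<Rightarrow> real \<Rightarrow> real \<Rightarrow> real \<Rightarrow> real \<Rightarrow> (nat \<Rightarrow> nat) \<Rightarrow> (nat \<Rightarrow> nat) \<Rightarrow> bool" where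
  "tangent b \<gamma> \<epsilon> \<delta> x0 i j \<longleftrightarrow>
     \<bar>S b \<gamma> x0 i - S b \<gamma> x0 j\<bar> \<le> \<epsilon> \<and> \<bar>S' b \<gamma> x0 i - S' b \<gamma> x0 j\<bar> \<le> \<delta>"

definition Eset :: "nat \<Rightarrow> real \<Rightarrow> nat \<Rightarrow> real \<Rightarrow> real \<Rightarrow> real \<Rightarrow> (nat list \<times> nat list) set" where
  "Eset b \<gamma> q x0 \<epsilon> \<delta> = {(k, l). k \<in> words b q \<and> l \<in> words b q \<and>
     (\<exists>u v. digit_seq b u \<and> digit_seq b v \<and>
        tangent b \<gamma> \<epsilon> \<delta> x0 (concat_seq k u) (concat_seq l v))}"

definition EJ :: "nat \<Rightarrow> real \<Rightarrow> nat \<Rightarrow> real set \<Rightarrow> (nat list \<times> nat list) set" where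
  "EJ b \<gamma> q J = (\<Inter>\<epsilon>\<in>{0<..}. \<Inter>\<delta>\<in>{0<..}. \<Union>x\<in>J. Eset b \<gamma> q x \<epsilon> \<delta>)"

definition eJ :: "nat \<Rightarrow> real \<Rightarrow> nat \<Rightarrow> real set \<Rightarrow> nat" where
  "eJ b \<gamma> q J = Max ((\<lambda>k. card {l. (k, l) \<in> EJ b \<gamma> q J}) ` words b q)"

definition e :: "nat \<Rightarrow> real \<Rightarrow> nat \<Rightarrow> real" where
  "e b \<gamma> q = lim (\<lambda>p. real (Max ((\<lambda>k. eJ b \<gamma> q {real k / real b ^ p .. (real k + 1) / real b ^ p}) ` {..<b ^ p})))"

definition weight :: "(real \<Rightarrow> real) \<Rightarrow> bool" where
  "weight \<omega> \<longleftrightarrow> \<omega> \<in> borel_measurable (restrict_space lebesgue {0..<1})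
     \<and> (\<forall>x\<in>{0..<1}. \<omega> x > 0)
     \<and> (\<exists>M. \<forall>x\<in>{0..<1}. \<omega> x \<le> M \<and> 1 / \<omega> x \<le> M)"

definition admissible :: "nat \<Rightarrow> real \<Rightarrow> nat \<Rightarrow> (real \<Rightarrow> nat list \<Rightarrow> nat list \<Rightarrow> real) \<Rightarrow> bool" where
  "admissible b \<gamma> q V \<longleftrightarrow>
     (\<forall>u\<in>words b q. \<forall>v\<in>words b q.
        (\<lambda>x. V x u v) \<in> borel_measurable (restrict_space lebesgue {0..<1})
        \<and> (\<forall>x\<in>{0..<1}. V x u v \<ge> 0))
     \<and> (\<exists>\<epsilon>>0. \<exists>\<delta>>0. \<forall>x\<in>{0..<1}. \<forall>u v. (u, v) \<in> Eset b \<gamma> q x \<epsilon> \<delta> \<longrightarrow>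
          V x u v * V x v u \<ge> 1)"

definition SigmaVw :: "nat \<Rightarrow> nat \<Rightarrow> (real \<Rightarrow> nat list \<Rightarrow> nat list \<Rightarrow> real) \<Rightarrow> (real \<Rightarrow> real) \<Rightarrow> real \<Rightarrow> real" where
  "SigmaVw b q V \<omega> x = Max ((\<lambda>u. \<omega> x / \<omega> (xmap b x u) * (\<Sum>v\<in>words b q. V x u v)) ` words b q)"

definition Linf_norm :: "(real \<Rightarrow> real) \<Rightarrow> ereal" where
  "Linf_norm f = esssup (restrict_space lebesgue {0..<1}) (\<lambda>x. ereal \<bar>f x\<bar>)"

definition sigma :: "nat \<Rightarrow> real \<Rightarrow> nat \<Rightarrow> ereal" where
  "sigma b \<gamma> q = Inf {Linf_norm (SigmaVw b q V \<omega>) | V \<omega>. weight \<omega> \<and> admissible b \<gamma> q V}"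

end

theory Submission
  imports Defs
begin

text \<open>Put \<open>\<theta>\<^sub>k = 2\<pi>(x + k)/b\<close>. Up to geometric tails, \<open>S\<close> and \<open>S'\<close> are \<open>sin \<theta>\<^sub>k\<close> and \<open>cos \<theta>\<^sub>k\<close>
  of the first digit \<open>k\<close>, so a pair \<open>(k,l)\<close> in \<open>E(1,x)\<close> satisfies \<open>\<bar>sin \<theta>\<^sub>k - sin \<theta>\<^sub>l\<bar> \<le> 2\<gamma>/(1 - \<gamma>)\<close> and
  \<open>\<bar>cos \<theta>\<^sub>k - cos \<theta>\<^sub>l\<bar> \<le> 2\<gamma>/(b - \<gamma>)\<close>. The second inequality makes \<open>sin ((\<theta>\<^sub>k + \<theta>\<^sub>l)/2)\<close> small, and for
  fixed \<open>k\<close> these half sums lie on a grid of mesh \<open>\<pi>/b\<close>; hence \<open>e(1) \<ge> 3\<close> forces \<open>\<gamma>b > e(1)\<close>.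
  For \<open>e(1) = 2\<close> both inequalities are combined through
  \<open>(sin \<theta>\<^sub>k - sin \<theta>\<^sub>l)\<^sup>2 + (cos \<theta>\<^sub>k - cos \<theta>\<^sub>l)\<^sup>2 = 4 sin\<^sup>2 (\<pi>(k - l)/b)\<close>.
  By compactness \<open>e(1)\<close> is realised by tangent pairs near a single point \<open>x\<close>, and \<open>\<sigma>(q) \<le> e(q)\<close> is
  witnessed by the indicator of \<open>E(q,J)\<close>, with \<open>J\<close> the \<open>b\<close>-adic interval containing \<open>x\<close>.\<close>

subsection \<open>Trigonometric estimates on a grid\<close>

text \<open>Concavity of \<open>sin\<close> on \<open>[0, pi]\<close>: the graph lies above the
  chord from the origin.\<close>

lemma sin_scale_ge:
  fixes t c :: real
  assumes "0 \<le> t" "t \<le> 1" "0 \<le> c" "c \<le> pi"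
  shows "t * sin c \<le> sin (t * c)"
proof -
  have "concave_on {0..pi} sin"
    by (rule f''_le0_imp_concave[where f' = cos and f'' = "\<lambda>x. - sin x"])
      (auto intro!: derivative_eq_intros sin_ge_zero)
  from concave_onD[OF this, of t 0 c] show ?thesis using assms by auto
qed

lemma jordan_sin:
  fixes r :: real
  assumes "\<bar>r\<bar> \<le> 1/2"
  shows "2 * \<bar>r\<bar> \<le> \<bar>sin (pi * r)\<bar>"
proof -
  have "2 * \<bar>r\<bar> * sin (pi/2) \<le> sin (2 * \<bar>r\<bar> * (pi/2))"
    by (rule sin_scale_ge) (use assms in auto)
  hence "2 * \<bar>r\<bar> \<le> sin (pi * \<bar>r\<bar>)" by (simp add: mult.commute)
  also have "\<dots> \<le> \<bar>sin (pi * r)\<bar>" by (cases "r \<ge> 0") auto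
  finally show ?thesis .
qed

text \<open>Reflection in \<open>pi / 2\<close> brings \<open>n\<close> to at most
  \<open>b / 2\<close>, where \<open>sin\<close> increases, so the smallest modulus occurs one grid
  step from a multiple of \<open>pi\<close>.\<close>

lemma abs_sin_grid_ge:
  fixes d :: int
  assumes "b \<ge> 2" "d \<noteq> 0" "\<bar>d\<bar> < int b"
  shows "sin (pi / real b) \<le> \<bar>sin (pi * of_int d / real b)\<bar>"
proof -
  define n where "n = real_of_int \<bar>d\<bar>"
  have n: "1 \<le> n" "n \<le> real b - 1" unfolding n_def using assms by linarith+
  have b: "real b \<ge> 2" using assms by simp
  have eq: "\<bar>sin (pi * of_int d / real b)\<bar> = \<bar>sin (pi * n / real b)\<bar>"
    unfolding n_def by (cases "d \<ge> 0") auto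
  have mono: "sin (pi / real b) \<le> sin (pi * m / real b)" if "1 \<le> m" "m \<le> real b / 2" for m
  proof (rule sin_monotone_2pi_le)
    show "- (pi / 2) \<le> pi / real b"
      by (smt (verit) b divide_nonneg_nonneg pi_ge_zero)
    show "pi / real b \<le> pi * m / real b" using that b by (simp add: divide_right_mono)
    show "pi * m / real b \<le> pi / 2" using that b by (simp add: field_simps)
  qed
  show ?thesis
  proof (cases "n \<le> real b / 2")
    case True
    thus ?thesis using mono[of n] n eq by linarith
  next
    case False
    have "sin (pi * (real b - n) / real b) = sin (pi - pi * n / real b)"
      using b by (simp add: field_simps)
    also have "\<dots> = sin (pi * n / real b)" by simp
    finally show ?thesis using mono[of "real b - n"] n eq False by linarith
  qed
qed

lemma abs_sin_diff_le:
  fixes x y :: real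
  shows "\<bar>sin (x - y)\<bar> \<le> \<bar>sin x\<bar> + \<bar>sin y\<bar>"
proof -
  have "\<bar>sin x * cos y\<bar> \<le> \<bar>sin x\<bar>" "\<bar>cos x * sin y\<bar> \<le> \<bar>sin y\<bar>"
    by (auto simp: abs_mult mult_left_le mult_left_le_one_le)
  thus ?thesis unfolding sin_diff by linarith
qed

lemma abs_sin_mult_le: "\<bar>sin (real n * x)\<bar> \<le> real n * \<bar>sin x\<bar>"
proof (induction n)
  case (Suc n)
  have "sin (real (Suc n) * x) = sin (real n * x) * cos x + cos (real n * x) * sin x"
    by (simp add: distrib_right sin_add add.commute)
  moreover have "\<bar>sin (real n * x) * cos x\<bar> \<le> \<bar>sin (real n * x)\<bar>"
    by (simp add: abs_mult mult_left_le)
  moreover have "\<bar>cos (real n * x) * sin x\<bar> \<le> \<bar>sin x\<bar>"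
    by (simp add: abs_mult mult_left_le_one_le)
  ultimately show ?case using Suc by (simp add: distrib_right)
qed simp

text \<open>Near \<open>pi / 2\<close> the angle \<open>2 * n * x\<close> is near
  \<open>n * pi\<close>, so an even multiple has small sine where \<open>cos x\<close> is small; the
  shift to \<open>pi / 2 - x\<close> reduces this to \<open>abs_sin_mult_le\<close>.\<close>

lemma abs_sin_even_mult_le: "\<bar>sin (2 * real n * x)\<bar> \<le> 2 * real n * \<bar>cos x\<bar>"
proof -
  have "sin (2 * real n * x) = - sin (real (2 * n) * (pi / 2 - x) - real n * pi)"
    by (simp add: algebra_simps)
  also have "\<bar>\<dots>\<bar> = \<bar>sin (real (2 * n) * (pi / 2 - x))\<bar>"
    by (simp add: sin_diff cos_npi sin_npi abs_mult)
  also have "\<dots> \<le> real (2 * n) * \<bar>sin (pi / 2 - x)\<bar>" by (rule abs_sin_mult_le)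
  finally show ?thesis by (simp add: sin_diff)
qed

text \<open>The arithmetic-geometric mean inequality for 1 and the squared sine; it improves the
  trivial bound 1 when the cosine is not small.\<close>

lemma abs_sin_le_cos_sq: "\<bar>sin x\<bar> \<le> 1 - (cos x)\<^sup>2 / 2" for x :: real
proof -
  have "0 \<le> (1 - \<bar>sin x\<bar>)\<^sup>2" by simp
  thus ?thesis by (simp add: power2_diff cos_squared_eq field_simps)
qed

lemma card_ints_le:
  fixes Z :: "int set" and A w :: real
  assumes "Z \<noteq> {}" and "\<And>z. z \<in> Z \<Longrightarrow> A \<le> of_int z \<and> of_int z \<le> A + w"
  shows "real (card Z) \<le> w + 1"
proof -
  have sub: "Z \<subseteq> {\<lceil>A\<rceil>..\<lfloor>A + w\<rfloor>}" using assms(2) by (auto simp: ceiling_le_iff le_floor_iff)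
  then have le: "\<lceil>A\<rceil> \<le> \<lfloor>A + w\<rfloor>" using assms(1) by fastforce
  have "card Z \<le> card {\<lceil>A\<rceil>..\<lfloor>A + w\<rfloor>}" using sub by (intro card_mono) auto
  hence "real (card Z) \<le> real_of_int (\<lfloor>A + w\<rfloor> - \<lceil>A\<rceil> + 1)"
    using le by (simp add: nat_le_iff)
  also have "\<dots> \<le> w + 1" by (simp; linarith)
  finally show ?thesis .
qed

text \<open>Each point \<open>y + l\<close> is reduced modulo \<open>b\<close> to the representative closest to \<open>0\<close>,
  where the sine dominates a linear function.\<close>

lemma card_sin_small:
  fixes y c :: real
  assumes b: "b \<ge> 1" and L: "L \<subseteq> {..<b}" "L \<noteq> {}"
    and small: "\<And>l. l \<in> L \<Longrightarrow> \<bar>sin (pi * (y + real l) / real b)\<bar> \<le> c"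
  shows "real (card L) - 1 \<le> real b * c"
proof -
  define n where "n l = round ((y + real l) / real b)" for l :: nat
  define z where "z l = int l - int b * n l" for l
  \<comment> \<open>The reduction preserves residues modulo \<open>b\<close>, and the elements of
    \<open>L\<close> are distinct residues.\<close>
  have inj: "inj_on z L"
  proof
    fix l l' assume l: "l \<in> L" "l' \<in> L" "z l = z l'"
    hence "int l mod int b = int l' mod int b" unfolding z_def
      by (metis mod_mult_self2 diff_add_cancel add.commute)
    thus "l = l'" using l L by (auto simp: subset_iff)
  qed
  have bound: "- y - real b * c / 2 \<le> of_int (z l) \<and> of_int (z l) \<le> - y - real b * c / 2 + real b * c"
    if "l \<in> L" for l
  proof -
    define r where "r = (y + real l) / real b - of_int (n l)"
    have r: "\<bar>r\<bar> \<le> 1/2" unfolding r_def n_def using of_int_round_abs_le[of "(y + real l) / real b"]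
      by (simp add: abs_minus_commute)
    have "pi * r = pi * (y + real l) / real b - pi * of_int (n l)"
      unfolding r_def by (simp add: algebra_simps)
    hence "\<bar>sin (pi * r)\<bar> = \<bar>sin (pi * (y + real l) / real b)\<bar>"
      by (simp add: sin_diff sin_npi_int cos_npi_int)
    hence "2 * \<bar>r\<bar> \<le> c" using jordan_sin[OF r] small[OF that] by linarith
    hence "real b * \<bar>r\<bar> \<le> real b * c / 2" using b by simp
    moreover have "real b * \<bar>r\<bar> = \<bar>real b * r\<bar>" by (simp add: abs_mult)
    moreover have "real b * r = y + of_int (z l)"
      unfolding r_def z_def using b by (simp add: field_simps)
    ultimately show ?thesis by linarith
  qed
  have "real (card (z ` L)) \<le> real b * c + 1"
    by (rule card_ints_le) (use bound L in auto)
  thus ?thesis using card_image[OF inj] by simp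
qed

subsection \<open>Tangency in terms of sines and cosines\<close>

text \<open>The phase of the \<open>n\<close>-th term of \<open>S\<close>; its derivative in
  \<open>x\<close> is \<open>2 * pi / b ^ Suc n\<close>.\<close>

definition angle :: "nat \<Rightarrow> real \<Rightarrow> (nat \<Rightarrow> nat) \<Rightarrow> nat \<Rightarrow> real" where
  "angle b x i n = 2 * pi * ((x + (\<Sum>k\<le>n. real (i k) * real b ^ k)) / real b ^ Suc n)"

lemma summable_geometric_bounded:
  fixes c :: "nat \<Rightarrow> real"
  assumes "0 \<le> r" "r < 1" "\<And>n. \<bar>c n\<bar> \<le> K"
  shows "summable (\<lambda>n. r ^ n * c n)"
proof (rule summable_comparison_test')
  show "summable (\<lambda>n. K * r ^ n)" using assms by (intro summable_mult summable_geometric) auto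
  show "norm (r ^ n * c n) \<le> K * r ^ n" if "n \<ge> 0" for n
    using assms by (simp add: abs_mult mult.commute mult_right_mono)
qed

lemma geometric_tail_le:
  fixes c :: "nat \<Rightarrow> real"
  assumes "0 \<le> r" "r < 1" "\<And>n. \<bar>c n\<bar> \<le> K"
  shows "\<bar>(\<Sum>n. r ^ n * c n) - (\<Sum>n<m. r ^ n * c n)\<bar> \<le> K * r ^ m / (1 - r)"
proof -
  have sm: "summable (\<lambda>n. r ^ n * c n)" by (rule summable_geometric_bounded) fact+
  have "(\<Sum>n. r ^ n * c n) - (\<Sum>n<m. r ^ n * c n) = (\<Sum>n. r ^ (n + m) * c (n + m))"
    using suminf_split_initial_segment[OF sm, of m] by simp
  also have "\<bar>\<dots>\<bar> \<le> (\<Sum>n. K * r ^ m * r ^ n)"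
  proof -
    have 1: "norm (r ^ (n + m) * c (n + m)) \<le> K * r ^ m * r ^ n" for n
      using mult_left_mono[OF assms(3)[of "n + m"], of "r ^ m * r ^ n"] assms(1)
      by (simp add: abs_mult power_add algebra_simps)
    have 2: "summable (\<lambda>n. K * r ^ m * r ^ n)" using assms by (intro summable_mult summable_geometric) auto
    have 3: "summable (\<lambda>n. norm (r ^ (n + m) * c (n + m)))"
      by (rule summable_comparison_test'[OF 2]) (use 1 in auto)
    have "\<bar>\<Sum>n. r ^ (n + m) * c (n + m)\<bar> \<le> (\<Sum>n. norm (r ^ (n + m) * c (n + m)))"
      using summable_norm[OF 3] by simp
    also have "\<dots> \<le> (\<Sum>n. K * r ^ m * r ^ n)" by (rule suminf_le[OF 1 3 2])
    finally show ?thesis .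
  qed
  also have "\<dots> = K * r ^ m / (1 - r)" using assms by (simp add: suminf_mult suminf_geometric)
  finally show ?thesis .
qed

lemma S_eq:
  assumes "0 \<le> \<gamma>" "\<gamma> < 1"
  shows "S b \<gamma> x i = - 2 * pi * (\<Sum>n. \<gamma> ^ n * sin (angle b x i n))"
proof -
  have "summable (\<lambda>n. \<gamma> ^ n * sin (angle b x i n))"
    by (rule summable_geometric_bounded[where K = 1]) (use assms in auto)
  from suminf_mult[OF this, of "- 2 * pi"] show ?thesis
    unfolding S_def psi_def angle_def by (simp add: algebra_simps)
qed

text \<open>Termwise differentiation by the Weierstrass M-test. The inner derivative turns the ratio
  \<open>\<gamma>\<close> into \<open>\<gamma> / b\<close>, so tangency restricts cosines more
  tightly than sines.\<close>

lemma S'_eq: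
  assumes b: "b \<ge> 1" and g: "0 \<le> \<gamma>" "\<gamma> < 1"
  shows "S' b \<gamma> x i = - (4 * pi\<^sup>2 / real b) * (\<Sum>n. (\<gamma> / real b) ^ n * cos (angle b x i n))"
proof -
  have gb: "0 \<le> \<gamma> / real b" "\<gamma> / real b < 1" using b g by (auto simp: divide_simps)
  define f where "f n y = - 2 * pi * (\<gamma> ^ n * sin (angle b y i n))" for n y
  define f' where "f' n y = - (4 * pi\<^sup>2 / real b) * ((\<gamma> / real b) ^ n * cos (angle b y i n))" for n y
  have der: "(f n has_field_derivative f' n y) (at y within UNIV)" for n y
    unfolding f_def f'_def angle_def using b
    by (auto intro!: derivative_eq_intros simp: field_simps power2_eq_square)
  have unif: "uniformly_convergent_on UNIV (\<lambda>n y. \<Sum>k<n. f' k y)"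
  proof (rule Weierstrass_m_test'_ev)
    show "\<forall>\<^sub>F n in sequentially. \<forall>y\<in>UNIV. norm (f' n y) \<le> 4 * pi\<^sup>2 / real b * (\<gamma> / real b) ^ n"
    proof (intro always_eventually allI ballI)
      fix n y
      have "norm (f' n y) = 4 * pi\<^sup>2 / real b * (\<gamma> / real b) ^ n * \<bar>cos (angle b y i n)\<bar>"
        unfolding f'_def using gb by (simp add: abs_mult)
      also have "\<dots> \<le> 4 * pi\<^sup>2 / real b * (\<gamma> / real b) ^ n * 1"
        by (rule mult_left_mono) (use gb in auto)
      finally show "norm (f' n y) \<le> 4 * pi\<^sup>2 / real b * (\<gamma> / real b) ^ n" by simp
    qed
    show "summable (\<lambda>n. 4 * pi\<^sup>2 / real b * (\<gamma> / real b) ^ n)"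
      using gb by (intro summable_mult summable_geometric) auto
  qed
  have sm: "summable (\<lambda>n. f n x)" unfolding f_def
    by (intro summable_mult summable_geometric_bounded[where K = 1]) (use g in auto)
  have "((\<lambda>y. \<Sum>n. f n y) has_field_derivative (\<Sum>n. f' n x)) (at x)"
    by (rule has_field_derivative_series'(2)[OF convex_UNIV der unif, of x]) (use sm in auto)
  moreover have "(\<Sum>n. f n y) = S b \<gamma> y i" for y
    unfolding S_eq[OF g] f_def
    by (rule suminf_mult) (rule summable_geometric_bounded[where K = 1], use g in auto)
  ultimately have "S' b \<gamma> x i = (\<Sum>n. f' n x)"
    unfolding S'_def by (simp add: DERIV_imp_deriv)
  also have "\<dots> = - (4 * pi\<^sup>2 / real b) * (\<Sum>n. (\<gamma> / real b) ^ n * cos (angle b x i n))"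
    unfolding f'_def
    by (rule suminf_mult) (rule summable_geometric_bounded[where K = 1], use gb in auto)
  finally show ?thesis .
qed

text \<open>The full series differ by at most \<open>\<epsilon>\<close>, and each of the two tails
  costs at most \<open>r ^ m / (1 - r)\<close>.\<close>

lemma geometric_heads_close:
  fixes c d :: "nat \<Rightarrow> real"
  assumes "0 \<le> r" "r < 1" "\<And>n. \<bar>c n\<bar> \<le> 1" "\<And>n. \<bar>d n\<bar> \<le> 1"
    and "\<bar>(\<Sum>n. r ^ n * c n) - (\<Sum>n. r ^ n * d n)\<bar> \<le> \<epsilon>"
  shows "\<bar>\<Sum>n<m. r ^ n * (c n - d n)\<bar> \<le> 2 * r ^ m / (1 - r) + \<epsilon>"
proof -
  have "(\<Sum>n<m. r ^ n * (c n - d n)) = (\<Sum>n<m. r ^ n * c n) - (\<Sum>n<m. r ^ n * d n)"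
    by (simp add: sum_subtractf right_diff_distrib)
  moreover have "\<bar>(\<Sum>n. r ^ n * c n) - (\<Sum>n<m. r ^ n * c n)\<bar> \<le> 1 * r ^ m / (1 - r)"
    by (rule geometric_tail_le) (use assms in auto)
  moreover have "\<bar>(\<Sum>n. r ^ n * d n) - (\<Sum>n<m. r ^ n * d n)\<bar> \<le> 1 * r ^ m / (1 - r)"
    by (rule geometric_tail_le) (use assms in auto)
  moreover have "2 * r ^ m / (1 - r) = 1 * r ^ m / (1 - r) + 1 * r ^ m / (1 - r)"
    by (simp add: add_divide_distrib)
  ultimately show ?thesis using assms(5) by linarith
qed

lemma tangent_sin:
  assumes "0 \<le> \<gamma>" "\<gamma> < 1" "tangent b \<gamma> \<epsilon> \<delta> x i j"
  shows "\<bar>\<Sum>n<m. \<gamma> ^ n * (sin (angle b x i n) - sin (angle b x j n))\<bar> \<le> 2 * \<gamma> ^ m / (1 - \<gamma>) + \<epsilon>"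
proof (rule geometric_heads_close)
  define D where "D = (\<Sum>n. \<gamma> ^ n * sin (angle b x i n)) - (\<Sum>n. \<gamma> ^ n * sin (angle b x j n))"
  have "\<bar>- 2 * pi * D\<bar> \<le> \<epsilon>"
    using assms(3) unfolding tangent_def S_eq[OF assms(1,2)] D_def by (simp add: algebra_simps)
  hence "2 * pi * \<bar>D\<bar> \<le> \<epsilon>" by (simp add: abs_mult)
  moreover have "1 * \<bar>D\<bar> \<le> 2 * pi * \<bar>D\<bar>" by (rule mult_right_mono) (use pi_gt3 in auto)
  ultimately show "\<bar>D\<bar> \<le> \<epsilon>" by linarith
qed (use assms in auto)

text \<open>The prefactor \<open>4 * pi^2 / b\<close> drops below 1 for large \<open>b\<close>,
  whence the error \<open>b * \<delta>\<close>; for the sine series the prefactor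
  \<open>2 * pi\<close> exceeds 1.\<close>

lemma tangent_cos:
  assumes "b \<ge> 1" "0 \<le> \<gamma>" "\<gamma> < 1" "tangent b \<gamma> \<epsilon> \<delta> x i j"
  shows "\<bar>\<Sum>n<m. (\<gamma> / real b) ^ n * (cos (angle b x i n) - cos (angle b x j n))\<bar>
           \<le> 2 * (\<gamma> / real b) ^ m / (1 - \<gamma> / real b) + real b * \<delta>"
proof (rule geometric_heads_close)
  define D where "D = (\<Sum>n. (\<gamma> / real b) ^ n * cos (angle b x i n))
    - (\<Sum>n. (\<gamma> / real b) ^ n * cos (angle b x j n))"
  have "\<bar>- (4 * pi\<^sup>2 / real b) * D\<bar> \<le> \<delta>"
    using assms(4) unfolding tangent_def S'_eq[OF assms(1-3)] D_def by (simp add: algebra_simps)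
  hence "4 * pi\<^sup>2 / real b * \<bar>D\<bar> \<le> \<delta>" by (simp add: abs_mult)
  hence "4 * pi\<^sup>2 * \<bar>D\<bar> \<le> real b * \<delta>" using assms(1) by (simp add: field_simps)
  moreover have "1 * \<bar>D\<bar> \<le> 4 * pi\<^sup>2 * \<bar>D\<bar>"
  proof (rule mult_right_mono)
    have "1 \<le> pi\<^sup>2" using pi_gt3 by (intro one_le_power) auto
    thus "1 \<le> 4 * pi\<^sup>2" by linarith
  qed auto
  ultimately show "\<bar>D\<bar> \<le> real b * \<delta>" by linarith
  show "\<gamma> / real b < 1" using assms by (auto simp: divide_simps)
qed (use assms in auto)

lemma words_1: "words b (Suc 0) = (\<lambda>k. [k]) ` {..<b}"
  unfolding words_def by (auto simp: length_Suc_conv)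

lemma finite_words: "finite (words b q)"
  unfolding words_def using finite_lists_length_eq[of "{..<b}" q] by (simp add: conj_commute)

lemma words_nonempty: "b \<ge> 1 \<Longrightarrow> words b q \<noteq> {}"
  unfolding words_def by (auto intro!: exI[of _ "replicate q 0"])

definition theta :: "nat \<Rightarrow> real \<Rightarrow> nat \<Rightarrow> real" where
  "theta b x k = 2 * pi * ((x + real k) / real b)"

lemma angle_0: "angle b x (concat_seq [k] u) 0 = theta b x k"
  by (simp add: angle_def concat_seq_def theta_def)

text \<open>Modulo \<open>2 * pi\<close> the first angle is \<open>b\<close> times the second; this
  coupling of consecutive terms decides the case \<open>b = 6\<close>.\<close>

lemma angle_1: "b \<ge> 1 \<Longrightarrow> real b * angle b x (concat_seq [k] u) 1 = theta b x k + 2 * pi * real (u 0)"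
  by (simp add: angle_def concat_seq_def theta_def field_simps)

text \<open>Heads of length one: all later digits are absorbed in the tails.\<close>

lemma Eset_1_sin_cos:
  assumes "b \<ge> 1" "0 \<le> \<gamma>" "\<gamma> < 1" "([k], [l]) \<in> Eset b \<gamma> 1 x \<epsilon> \<delta>"
  shows "\<bar>sin (theta b x k) - sin (theta b x l)\<bar> \<le> 2 * \<gamma> / (1 - \<gamma>) + \<epsilon>"
    and "\<bar>cos (theta b x k) - cos (theta b x l)\<bar> \<le> 2 * \<gamma> / (real b - \<gamma>) + real b * \<delta>"
proof -
  from assms(4) obtain u v where t: "tangent b \<gamma> \<epsilon> \<delta> x (concat_seq [k] u) (concat_seq [l] v)"
    unfolding Eset_def by auto
  show "\<bar>sin (theta b x k) - sin (theta b x l)\<bar> \<le> 2 * \<gamma> / (1 - \<gamma>) + \<epsilon>"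
    using tangent_sin[OF assms(2,3) t, of 1] by (simp add: angle_0)
  have eq: "2 * (\<gamma> / real b) / (1 - \<gamma> / real b) = 2 * \<gamma> / (real b - \<gamma>)"
  proof -
    have "1 - \<gamma> / real b = (real b - \<gamma>) / real b" using assms(1) by (simp add: field_simps)
    thus ?thesis using assms(1) by simp
  qed
  show "\<bar>cos (theta b x k) - cos (theta b x l)\<bar> \<le> 2 * \<gamma> / (real b - \<gamma>) + real b * \<delta>"
    using tangent_cos[OF assms(1-3) t, of 1] unfolding power_one_right eq by (simp add: angle_0)
qed

lemma theta_sum_half: "(theta b x k + theta b x l) / 2 = pi * (2 * x + real k + real l) / real b"
  by (cases "b = 0") (simp_all add: theta_def field_simps)

lemma theta_diff_half: "(theta b x k - theta b x l) / 2 = pi * of_int (int k - int l) / real b"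
  by (cases "b = 0") (simp_all add: theta_def field_simps)

lemma grid_sin_ge:
  assumes "b \<ge> 2" "k < b" "l < b" "k \<noteq> l"
  shows "sin (pi / real b) \<le> \<bar>sin ((theta b x k - theta b x l) / 2)\<bar>"
  unfolding theta_diff_half by (rule abs_sin_grid_ge) (use assms in auto)

lemma abs_cos_diff:
  fixes t s :: real
  shows "\<bar>cos t - cos s\<bar> = 2 * \<bar>sin ((t + s) / 2)\<bar> * \<bar>sin ((t - s) / 2)\<bar>"
proof -
  have "sin ((s - t) / 2) = - sin ((t - s) / 2)"
    using sin_minus[of "(t - s) / 2"] by (simp add: minus_divide_left)
  thus ?thesis unfolding cos_diff_cos by (simp add: abs_mult)
qed

text \<open>The squared chord between two points of the unit circle, by coordinates and by
  angle.\<close>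

lemma sin_cos_diff_sq:
  fixes t s :: real
  shows "(sin t - sin s)\<^sup>2 + (cos t - cos s)\<^sup>2 = 4 * (sin ((t - s) / 2))\<^sup>2"
proof -
  have "(cos t - cos s)\<^sup>2 = (2 * sin ((t + s) / 2) * sin ((t - s) / 2))\<^sup>2"
    unfolding power2_abs[of "cos t - cos s", symmetric] abs_cos_diff by (simp add: power_mult_distrib)
  moreover have "sin t - sin s = 2 * sin ((t - s) / 2) * cos ((t + s) / 2)" by (rule sin_diff_sin)
  ultimately show ?thesis using sin_cos_squared_add[of "(t + s) / 2"] by algebra
qed

text \<open>A difference of cosines is twice the product of the sines of half sum and half
  difference; the latter is at least \<open>sin (pi / b)\<close> for distinct digits.\<close>

lemma sin_mid_le:
  assumes "b \<ge> 2" "k < b" "l < b" "k \<noteq> l"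
    and "\<bar>cos (theta b x k) - cos (theta b x l)\<bar> \<le> 2 * c"
  shows "\<bar>sin (pi * (2 * x + real k + real l) / real b)\<bar> * sin (pi / real b) \<le> c"
proof -
  have "\<bar>sin (pi * (2 * x + real k + real l) / real b)\<bar> * sin (pi / real b)
    \<le> \<bar>sin (pi * (2 * x + real k + real l) / real b)\<bar> * \<bar>sin ((theta b x k - theta b x l) / 2)\<bar>"
    by (intro mult_left_mono grid_sin_ge) (use assms in auto)
  also have "\<dots> \<le> c" using assms(5) unfolding abs_cos_diff theta_sum_half by simp
  finally show ?thesis .
qed

subsection \<open>Limit points of tangent pairs and testing functions\<close>

lemma Eset_subset_words: "Eset b \<gamma> q x \<epsilon> \<delta> \<subseteq> words b q \<times> words b q"
  unfolding Eset_def by auto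

lemma Eset_mono: "\<epsilon> \<le> \<epsilon>' \<Longrightarrow> \<delta> \<le> \<delta>' \<Longrightarrow> Eset b \<gamma> q x \<epsilon> \<delta> \<subseteq> Eset b \<gamma> q x \<epsilon>' \<delta>'"
  unfolding Eset_def tangent_def by (clarify; metis order_trans)

lemma Eset_sym: "(u, v) \<in> Eset b \<gamma> q x \<epsilon> \<delta> \<Longrightarrow> (v, u) \<in> Eset b \<gamma> q x \<epsilon> \<delta>"
  unfolding Eset_def tangent_def by (auto simp: abs_minus_commute)

lemma EJ_mono: "J \<subseteq> J' \<Longrightarrow> EJ b \<gamma> q J \<subseteq> EJ b \<gamma> q J'"
  unfolding EJ_def by blast

lemma EJ_subset_words: "EJ b \<gamma> q J \<subseteq> words b q \<times> words b q"
proof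
  fix w assume "w \<in> EJ b \<gamma> q J"
  then obtain x where "w \<in> Eset b \<gamma> q x 1 1" unfolding EJ_def by fastforce
  thus "w \<in> words b q \<times> words b q" using Eset_subset_words by blast
qed

lemma EJ_sym: "(u, v) \<in> EJ b \<gamma> q J \<Longrightarrow> (v, u) \<in> EJ b \<gamma> q J"
  unfolding EJ_def INT_iff UN_iff using Eset_sym by meson

text \<open>Only finitely many pairs of words exist, and each pair outside \<open>EJ\<close> is
  excluded on all of \<open>J\<close> by some threshold; the smallest threshold serves them
  all.\<close>

lemma EJ_attained:
  obtains \<epsilon> \<delta> where "\<epsilon> > 0" "\<delta> > 0" "\<And>x. x \<in> J \<Longrightarrow> Eset b \<gamma> q x \<epsilon> \<delta> \<subseteq> EJ b \<gamma> q J"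
proof -
  define W where "W = words b q \<times> words b q - EJ b \<gamma> q J"
  have fin: "finite W" unfolding W_def by (simp add: finite_words)
  have "\<exists>\<epsilon>>0. \<forall>x\<in>J. w \<notin> Eset b \<gamma> q x \<epsilon> \<epsilon>" if "w \<in> W" for w
  proof -
    from that obtain \<epsilon> \<delta> where "\<epsilon> > 0" "\<delta> > 0" "\<forall>x\<in>J. w \<notin> Eset b \<gamma> q x \<epsilon> \<delta>"
      unfolding W_def EJ_def by auto
    thus ?thesis
      using Eset_mono[of "min \<epsilon> \<delta>" \<epsilon> "min \<epsilon> \<delta>" \<delta>]
      by (intro exI[of _ "min \<epsilon> \<delta>"]) (simp, blast)
  qed
  then obtain f where f: "\<And>w. w \<in> W \<Longrightarrow> f w > (0::real)"
    "\<And>w x. w \<in> W \<Longrightarrow> x \<in> J \<Longrightarrow> w \<notin> Eset b \<gamma> q x (f w) (f w)"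
    by metis
  \<comment> \<open>Inserting 1 covers an empty \<open>W\<close>.\<close>
  define m where "m = Min (insert 1 (f ` W))"
  have m: "m > 0" "\<And>w. w \<in> W \<Longrightarrow> m \<le> f w" unfolding m_def using fin f(1) by auto
  have "Eset b \<gamma> q x m m \<subseteq> EJ b \<gamma> q J" if "x \<in> J" for x
  proof
    fix w assume w: "w \<in> Eset b \<gamma> q x m m"
    show "w \<in> EJ b \<gamma> q J"
    proof (rule ccontr)
      assume "w \<notin> EJ b \<gamma> q J"
      hence "w \<in> W" unfolding W_def using subsetD[OF Eset_subset_words w] by blast
      thus False using f(2)[OF _ that] w Eset_mono[of m "f w" m "f w"] m(2) by blast
    qed
  qed
  thus thesis using m that by blast
qed

lemma finite_EJ_section: "finite {l. (k, l) \<in> EJ b \<gamma> q J}"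
  by (rule finite_subset[OF _ finite_words[of b q]]) (use EJ_subset_words in blast)

lemma card_EJ_section_le_eJ: "k \<in> words b q \<Longrightarrow> card {l. (k, l) \<in> EJ b \<gamma> q J} \<le> eJ b \<gamma> q J"
  unfolding eJ_def by (intro Max_ge) (auto simp: finite_words)

lemma eJ_attained:
  assumes "b \<ge> 1"
  obtains k where "k \<in> words b q" "eJ b \<gamma> q J = card {l. (k, l) \<in> EJ b \<gamma> q J}"
proof -
  have "eJ b \<gamma> q J \<in> (\<lambda>k. card {l. (k, l) \<in> EJ b \<gamma> q J}) ` words b q"
    unfolding eJ_def by (rule Max_in) (auto simp: finite_words words_nonempty[OF assms])
  thus thesis using that by auto
qed

lemma eJ_mono:
  assumes "b \<ge> 1" "J \<subseteq> J'"
  shows "eJ b \<gamma> q J \<le> eJ b \<gamma> q J'"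
proof -
  obtain k where k: "k \<in> words b q" "eJ b \<gamma> q J = card {l. (k, l) \<in> EJ b \<gamma> q J}"
    using eJ_attained[OF assms(1)] by blast
  have "card {l. (k, l) \<in> EJ b \<gamma> q J} \<le> card {l. (k, l) \<in> EJ b \<gamma> q J'}"
    by (rule card_mono[OF finite_EJ_section]) (use EJ_mono[OF assms(2)] in blast)
  thus ?thesis using k card_EJ_section_le_eJ[OF k(1)] by (metis order_trans)
qed

section \<open>b-adic intervals and the limit defining \<open>e\<close>\<close>

definition badic :: "nat \<Rightarrow> nat \<Rightarrow> nat \<Rightarrow> real set" where
  "badic b p k = {real k / real b ^ p .. (real k + 1) / real b ^ p}"

text \<open>A term of the sequence with limit \<open>e\<close>, kept as a natural number so that
  monotonicity makes it eventually constant.\<close>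

definition e_level :: "nat \<Rightarrow> real \<Rightarrow> nat \<Rightarrow> nat \<Rightarrow> nat" where
  "e_level b \<gamma> q p = Max ((\<lambda>k. eJ b \<gamma> q (badic b p k)) ` {..<b ^ p})"

lemma eJ_le_e_level: "k < b ^ p \<Longrightarrow> eJ b \<gamma> q (badic b p k) \<le> e_level b \<gamma> q p"
  unfolding e_level_def by (intro Max_ge) auto

lemma e_level_attained:
  assumes "b \<ge> 1"
  obtains k where "k < b ^ p" "e_level b \<gamma> q p = eJ b \<gamma> q (badic b p k)"
proof -
  have "0 < b ^ p" using assms by simp
  hence "{..<b ^ p} \<noteq> {}" by blast
  hence "e_level b \<gamma> q p \<in> (\<lambda>k. eJ b \<gamma> q (badic b p k)) ` {..<b ^ p}"
    unfolding e_level_def by (intro Max_in) auto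
  thus thesis using that by auto
qed

lemma badic_Suc_subset:
  assumes "b \<ge> 1"
  shows "badic b (Suc p) k \<subseteq> badic b p (k div b)"
proof -
  have b: "real b > 0" using assms by simp
  have "k div b * b \<le> k" by simp
  hence 1: "real (k div b) * real b \<le> real k" by (metis of_nat_le_iff of_nat_mult)
  have "k + 1 \<le> (k div b + 1) * b" using assms dividend_less_div_times[of b k] by simp
  hence 2: "real k + 1 \<le> (real (k div b) + 1) * real b"
    by (metis of_nat_le_iff of_nat_mult of_nat_add of_nat_1)
  have "real (k div b) / real b ^ p = real (k div b) * real b / real b ^ Suc p"
    "(real (k div b) + 1) / real b ^ p = (real (k div b) + 1) * real b / real b ^ Suc p"
    using b by simp_all
  moreover have "real (k div b) * real b / real b ^ Suc p \<le> real k / real b ^ Suc p"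
    "(real k + 1) / real b ^ Suc p \<le> (real (k div b) + 1) * real b / real b ^ Suc p"
    using 1 2 b by (intro divide_right_mono; simp)+
  ultimately show ?thesis unfolding badic_def atLeastatMost_subset_iff by linarith
qed

text \<open>An interval realising the maximum at level \<open>Suc p\<close> lies in its parent, of
  index \<open>k div b\<close>, where \<open>eJ\<close> is at least as large.\<close>

lemma e_level_decreasing: "b \<ge> 1 \<Longrightarrow> decseq (e_level b \<gamma> q)"
proof (rule decseq_SucI)
  fix p assume b: "b \<ge> 1"
  obtain k where k: "k < b ^ Suc p" "e_level b \<gamma> q (Suc p) = eJ b \<gamma> q (badic b (Suc p) k)"
    using e_level_attained[OF b] by blast
  have "k div b < b ^ p" using k(1) by (simp add: less_mult_imp_div_less mult.commute)
  thus "e_level b \<gamma> q (Suc p) \<le> e_level b \<gamma> q p"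
    unfolding k(2) using eJ_mono[OF b badic_Suc_subset[OF b]] eJ_le_e_level order_trans by metis
qed

text \<open>A decreasing sequence of natural numbers is eventually constant, so the limit exists and
  is reached at a finite level.\<close>

lemma e_eq_e_level:
  assumes "b \<ge> 1"
  obtains P where "\<And>p. p \<ge> P \<Longrightarrow> e b \<gamma> q = real (e_level b \<gamma> q p)"
proof -
  obtain P where P: "\<And>p. e_level b \<gamma> q P \<le> e_level b \<gamma> q p"
    using arg_min_nat_le[of "\<lambda>_. True" _ "e_level b \<gamma> q"] by (metis (full_types))
  have const: "e_level b \<gamma> q p = e_level b \<gamma> q P" if "p \<ge> P" for p
    using P[of p] decseqD[OF e_level_decreasing[OF assms] that] by (rule antisym[rotated])
  have "(\<lambda>p. real (e_level b \<gamma> q p)) \<longlonglongrightarrow> real (e_level b \<gamma> q P)"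
    by (rule tendsto_eventually, rule eventually_sequentiallyI[of P], rule arg_cong[OF const])
  hence e: "e b \<gamma> q = real (e_level b \<gamma> q P)"
    unfolding e_def e_level_def badic_def by (rule limI)
  show thesis by (rule that[of P]) (unfold e, rule arg_cong[OF const[symmetric]])
qed

section \<open>Testing functions and upper bounds for \<open>sigma\<close>\<close>

text \<open>Tests the infimum on a single \<open>V\<close> with the constant weight 1; any tuning
  goes into \<open>V\<close>.\<close>

lemma sigma_le:
  assumes "admissible b \<gamma> q V"
    and "SigmaVw b q V (\<lambda>_. 1) \<in> borel_measurable (restrict_space lebesgue {0..<1})"
    and "\<And>x. x \<in> {0..<1} \<Longrightarrow> \<bar>SigmaVw b q V (\<lambda>_. 1) x\<bar> \<le> c"
  shows "sigma b \<gamma> q \<le> ereal c"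
proof -
  have "weight (\<lambda>_. 1)" unfolding weight_def by auto
  hence "sigma b \<gamma> q \<le> Linf_norm (SigmaVw b q V (\<lambda>_. 1))"
    unfolding sigma_def using assms(1) by (intro Inf_lower) blast
  also have "\<dots> \<le> ereal c" unfolding Linf_norm_def
  proof (rule esssup_I)
    show "(\<lambda>x. ereal \<bar>SigmaVw b q V (\<lambda>_. 1) x\<bar>) \<in> borel_measurable (restrict_space lebesgue {0..<1})"
      using assms(2) by measurable
    show "AE x in restrict_space lebesgue {0..<1}. ereal \<bar>SigmaVw b q V (\<lambda>_. 1) x\<bar> \<le> ereal c"
      using assms(3) by (intro AE_I2) (auto simp: space_restrict_space)
  qed
  finally show ?thesis .
qed

text \<open>Covers functions constant on b-adic intervals, with \<open>a = b ^ p\<close>.\<close>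

lemma floor_step_measurable:
  fixes g :: "int \<Rightarrow> real"
  shows "(\<lambda>x::real. g \<lfloor>x * a\<rfloor>) \<in> borel_measurable (restrict_space lebesgue A)"
proof (rule measurable_restrict_space1)
  have "(\<lambda>x::real. \<lfloor>x * a\<rfloor>) \<in> borel \<rightarrow>\<^sub>M count_space UNIV" by measurable
  hence "(\<lambda>x::real. g \<lfloor>x * a\<rfloor>) \<in> borel_measurable borel"
    by (rule measurable_compose) simp
  thus "(\<lambda>x::real. g \<lfloor>x * a\<rfloor>) \<in> borel_measurable lebesgue"
    by (simp add: measurable_completion)
qed

text \<open>Row sums of the indicator count the partners of \<open>u\<close> over one b-adic
  interval, hence are at most \<open>e_level\<close>; symmetry of \<open>EJ\<close> makes both
  factors in the admissibility condition equal to 1.\<close>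

lemma sigma_le_e:
  assumes b: "b \<ge> 2"
  shows "sigma b \<gamma> q \<le> ereal (e b \<gamma> q)"
proof -
  have b1: "b \<ge> 1" using b by simp
  obtain p where p: "e b \<gamma> q = real (e_level b \<gamma> q p)" using e_eq_e_level[OF b1] by blast
  define V0 where "V0 k u v = (if (u, v) \<in> EJ b \<gamma> q (badic b p k) then 1 else 0 :: real)" for k u v
  define idx where "idx x = nat \<lfloor>x * real b ^ p\<rfloor>" for x :: real
  define V where "V x = V0 (idx x)" for x
  have bp: "real b ^ p > 0" using b by simp
  have idx: "idx x < b ^ p" "x \<in> badic b p (idx x)" if x: "x \<in> {0..<1}" for x
  proof -
    have 0: "0 \<le> x * real b ^ p" using x by simp
    have "x * real b ^ p < 1 * real b ^ p" using x bp by (intro mult_strict_right_mono) auto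
    hence "\<lfloor>x * real b ^ p\<rfloor> < int (b ^ p)" by (simp add: floor_less_iff)
    thus "idx x < b ^ p" unfolding idx_def using 0 by (simp add: nat_less_iff)
    have "real (idx x) = of_int \<lfloor>x * real b ^ p\<rfloor>" unfolding idx_def using 0 by simp
    hence "real (idx x) \<le> x * real b ^ p" "x * real b ^ p \<le> real (idx x) + 1" by linarith+
    thus "x \<in> badic b p (idx x)" unfolding badic_def using bp by (simp add: field_simps)
  qed
  have "\<exists>\<epsilon>>0. \<forall>x\<in>badic b p k. Eset b \<gamma> q x \<epsilon> \<epsilon> \<subseteq> EJ b \<gamma> q (badic b p k)" for k
  proof -
    obtain \<epsilon> \<delta> where "\<epsilon> > 0" "\<delta> > 0"
      "\<And>x. x \<in> badic b p k \<Longrightarrow> Eset b \<gamma> q x \<epsilon> \<delta> \<subseteq> EJ b \<gamma> q (badic b p k)"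
      using EJ_attained by blast
    thus ?thesis
      using Eset_mono[of "min \<epsilon> \<delta>" \<epsilon> "min \<epsilon> \<delta>" \<delta>]
      by (intro exI[of _ "min \<epsilon> \<delta>"]) (simp, blast)
  qed
  then obtain f where f: "\<And>k. f k > 0"
    "\<And>k x. x \<in> badic b p k \<Longrightarrow> Eset b \<gamma> q x (f k) (f k) \<subseteq> EJ b \<gamma> q (badic b p k)"
    by metis
  \<comment> \<open>Level \<open>p\<close> has finitely many intervals, so one threshold serves all
    \<open>x\<close>.\<close>
  define m where "m = Min (f ` {..<b ^ p})"
  have ne: "{..<b ^ p} \<noteq> {}" using b by (simp add: lessThan_empty_iff)
  have m: "m > 0" "\<And>k. k < b ^ p \<Longrightarrow> m \<le> f k" unfolding m_def using f(1) ne by auto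
  have sub: "Eset b \<gamma> q x m m \<subseteq> EJ b \<gamma> q (badic b p (idx x))" if "x \<in> {0..<1}" for x
    using f(2)[OF idx(2)[OF that]] Eset_mono[OF m(2) m(2), OF idx(1)[OF that] idx(1)[OF that]] by blast
  show ?thesis
  proof (rule sigma_le)
    show "admissible b \<gamma> q V" unfolding admissible_def
    proof (intro conjI ballI)
      fix u v
      show "(\<lambda>x. V x u v) \<in> borel_measurable (restrict_space lebesgue {0..<1})"
        unfolding V_def idx_def by (rule floor_step_measurable)
      show "V x u v \<ge> 0" for x unfolding V_def V0_def by simp
    next
      have "V x u v * V x v u \<ge> 1" if "x \<in> {0..<1}" "(u, v) \<in> Eset b \<gamma> q x m m" for x u v
        using sub[OF that(1)] that(2) EJ_sym unfolding V_def V0_def by (simp add: subset_iff)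
      thus "\<exists>\<epsilon>>0. \<exists>\<delta>>0. \<forall>x\<in>{0..<1}. \<forall>u v. (u, v) \<in> Eset b \<gamma> q x \<epsilon> \<delta> \<longrightarrow> V x u v * V x v u \<ge> 1"
        using m(1) by blast
    qed
    have eq: "SigmaVw b q V (\<lambda>_. 1) x =
        Max ((\<lambda>u. \<Sum>v\<in>words b q. V0 (nat \<lfloor>x * real b ^ p\<rfloor>) u v) ` words b q)" for x
      unfolding SigmaVw_def V_def idx_def by simp
    show "SigmaVw b q V (\<lambda>_. 1) \<in> borel_measurable (restrict_space lebesgue {0..<1})"
      unfolding eq by (rule floor_step_measurable)
    show "\<bar>SigmaVw b q V (\<lambda>_. 1) x\<bar> \<le> e b \<gamma> q" if x: "x \<in> {0..<1}" for x
    proof -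
      have sum: "(\<Sum>v\<in>words b q. V x u v) = real (card {v. (u, v) \<in> EJ b \<gamma> q (badic b p (idx x))})" for u
      proof -
        have "words b q \<inter> {v. (u, v) \<in> EJ b \<gamma> q (badic b p (idx x))}
            = {v. (u, v) \<in> EJ b \<gamma> q (badic b p (idx x))}"
          using EJ_subset_words by blast
        thus ?thesis unfolding V_def V0_def by (simp add: sum.If_cases finite_words)
      qed
      have "SigmaVw b q V (\<lambda>_. 1) x \<in> (\<lambda>u. \<Sum>v\<in>words b q. V x u v) ` words b q"
        unfolding SigmaVw_def using Max_in[of "(\<lambda>u. \<Sum>v\<in>words b q. V x u v) ` words b q"]
        by (simp add: finite_words words_nonempty[OF b1])
      then obtain u where u: "u \<in> words b q" "SigmaVw b q V (\<lambda>_. 1) x = (\<Sum>v\<in>words b q. V x u v)"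
        by blast
      show ?thesis unfolding u(2) sum p
        using card_EJ_section_le_eJ[OF u(1)] eJ_le_e_level[OF idx(1)[OF x]]
        by (simp) (meson order_trans)
    qed
  qed
qed

section \<open>Passage to a limit point by compactness\<close>

text \<open>At every level an interval and a word realising the maximum are chosen. A subsequence of
  the left endpoints converges to \<open>x\<close>, and the pigeonhole principle fixes the word and
  its set of partners infinitely often along it. The nearby point \<open>x'\<close> may depend on
  \<open>l\<close> and on the tolerances.\<close>

lemma e_limit_point:
  assumes b: "b \<ge> 2"
  obtains N x k L where "e b \<gamma> q = real N" "k \<in> words b q" "L \<subseteq> words b q" "card L = N"
    "\<And>l \<eta> \<epsilon> \<delta>. l \<in> L \<Longrightarrow> \<eta> > 0 \<Longrightarrow> \<epsilon> > 0 \<Longrightarrow> \<delta> > 0 \<Longrightarrow>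
       \<exists>x'. \<bar>x' - x\<bar> < \<eta> \<and> (k, l) \<in> Eset b \<gamma> q x' \<epsilon> \<delta>"
proof -
  have b1: "b \<ge> 1" using b by simp
  obtain P where P: "\<And>p. p \<ge> P \<Longrightarrow> e b \<gamma> q = real (e_level b \<gamma> q p)"
    using e_eq_e_level[OF b1] by blast
  define N where "N = e_level b \<gamma> q P"
  have N: "e_level b \<gamma> q p = N" if "p \<ge> P" for p
    using P[OF that] P[of P] unfolding N_def by simp
  have "\<exists>j w. j < b ^ p \<and> w \<in> words b q \<and> e_level b \<gamma> q p = card {l. (w, l) \<in> EJ b \<gamma> q (badic b p j)}" for p
    by (metis e_level_attained[OF b1] eJ_attained[OF b1])
  then obtain j w where jw: "\<And>p. j p < b ^ p" "\<And>p. w p \<in> words b q"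
    "\<And>p. e_level b \<gamma> q p = card {l. (w p, l) \<in> EJ b \<gamma> q (badic b p (j p))}" by metis
  define L where "L p = {l. (w p, l) \<in> EJ b \<gamma> q (badic b p (j p))}" for p
  have L: "L p \<subseteq> words b q" for p unfolding L_def using EJ_subset_words by blast
  define y where "y p = real (j p) / real b ^ p" for p
  have "y p \<in> {0..1}" for p
  proof -
    have "real (j p) \<le> real b ^ p" using jw(1)[of p]
      by (metis less_imp_le of_nat_le_iff of_nat_power)
    thus ?thesis unfolding y_def using b by (simp add: divide_simps)
  qed
  then obtain x r where r: "strict_mono r" "(y \<circ> r) \<longlonglongrightarrow> x"
    using compact_imp_seq_compact[OF compact_Icc[of "0::real" 1]] unfolding seq_compact_def by blast
  define f where "f n = (w (r n), L (r n))" for n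
  have "finite (f ` {P..})"
    by (rule finite_subset[of _ "words b q \<times> Pow (words b q)"])
      (use jw(2) L in \<open>auto simp: f_def finite_words\<close>)
  moreover have "infinite {P..}" by (rule infinite_Ici)
  ultimately obtain n0 where n0: "n0 \<ge> P" "infinite {n \<in> {P..}. f n = f n0}"
    using pigeonhole_infinite[of "{P..}" f] by auto
  show thesis
  proof (rule that)
    show "e b \<gamma> q = real N" unfolding N_def by (rule P) simp
    show "w (r n0) \<in> words b q" by (rule jw)
    show "L (r n0) \<subseteq> words b q" by (rule L)
    \<comment> \<open>From level \<open>P\<close> on, the maximum has its stable value
      \<open>N\<close>.\<close>
    have "P \<le> r n0" using n0(1) seq_suble[OF r(1), of n0] by simp
    thus "card (L (r n0)) = N" using jw(3)[of "r n0"] N unfolding L_def by simp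
    fix l and \<eta> \<epsilon> \<delta> :: real
    assume l: "l \<in> L (r n0)" and pos: "\<eta> > 0" "\<epsilon> > 0" "\<delta> > 0"
    have "(\<lambda>n. (1 / real b) ^ n) \<longlonglongrightarrow> 0" by (rule LIMSEQ_realpow_zero) (use b in auto)
    hence "(\<lambda>n. (1 / real b) ^ r n) \<longlonglongrightarrow> 0"
      using LIMSEQ_subseq_LIMSEQ[OF _ r(1)] by (fastforce simp: o_def)
    hence "\<forall>\<^sub>F n in sequentially. (1 / real b) ^ r n < \<eta> / 2"
      using pos by (intro order_tendstoD(2)[of _ 0]) auto
    moreover have "\<forall>\<^sub>F n in sequentially. \<bar>y (r n) - x\<bar> < \<eta> / 2"
      using tendstoD[OF r(2), of "\<eta> / 2"] pos by (simp add: dist_real_def)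
    ultimately obtain M where M: "\<And>n. n \<ge> M \<Longrightarrow> (1 / real b) ^ r n < \<eta> / 2 \<and> \<bar>y (r n) - x\<bar> < \<eta> / 2"
      unfolding eventually_sequentially by (metis nle_le order_trans)
    obtain n where n: "n \<ge> M" "f n = f n0"
      using n0(2) unfolding infinite_nat_iff_unbounded_le by blast
    have "(w (r n0), l) \<in> EJ b \<gamma> q (badic b (r n) (j (r n)))"
      using l n(2) unfolding f_def L_def by auto
    then obtain x' where x': "x' \<in> badic b (r n) (j (r n))" "(w (r n0), l) \<in> Eset b \<gamma> q x' \<epsilon> \<delta>"
      using pos unfolding EJ_def by auto
    have "y (r n) \<le> x'" "x' \<le> y (r n) + (1 / real b) ^ r n"
      using x'(1) unfolding badic_def y_def by (auto simp: add_divide_distrib power_one_over)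
    hence "\<bar>x' - x\<bar> < \<eta>" using M[OF n(1)] by linarith
    thus "\<exists>x'. \<bar>x' - x\<bar> < \<eta> \<and> (w (r n0), l) \<in> Eset b \<gamma> q x' \<epsilon> \<delta>" using x'(2) by blast
  qed
qed

lemma isCont_limit_le:
  fixes f :: "real \<Rightarrow> real"
  assumes "isCont f x" and approx: "\<And>\<eta> \<epsilon>. \<eta> > 0 \<Longrightarrow> \<epsilon> > 0 \<Longrightarrow> \<exists>x'. \<bar>x' - x\<bar> < \<eta> \<and> f x' \<le> c + \<epsilon>"
  shows "f x \<le> c"
proof (rule field_le_epsilon)
  fix e :: real assume e: "e > 0"
  obtain d where d: "d > 0" "\<And>x'. \<bar>x' - x\<bar> < d \<Longrightarrow> \<bar>f x' - f x\<bar> < e / 2"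
    using assms(1) e unfolding continuous_at_eps_delta dist_real_def by (meson half_gt_zero)
  obtain x' where "\<bar>x' - x\<bar> < d" "f x' \<le> c + e / 2" using approx[OF d(1), of "e / 2"] e by auto
  thus "f x \<le> c + e" using d(2)[of x'] by linarith
qed

text \<open>Continuity in \<open>x\<close> removes the slack of \<open>Eset_1_sin_cos\<close>. The
  last conclusion keeps actual tangent pairs, because \<open>b = 6\<close> needs the second digit
  too.\<close>

lemma e_1_limit_point:
  assumes b: "b \<ge> 2" and g: "0 \<le> \<gamma>" "\<gamma> < 1"
  obtains N x k L where "e b \<gamma> 1 = real N" "k < b" "L \<subseteq> {..<b}" "card L = N"
    "\<And>l. l \<in> L \<Longrightarrow> \<bar>sin (theta b x k) - sin (theta b x l)\<bar> \<le> 2 * \<gamma> / (1 - \<gamma>)"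
    "\<And>l. l \<in> L \<Longrightarrow> \<bar>cos (theta b x k) - cos (theta b x l)\<bar> \<le> 2 * \<gamma> / (real b - \<gamma>)"
    "\<And>l \<epsilon> \<delta>. l \<in> L \<Longrightarrow> \<epsilon> > 0 \<Longrightarrow> \<delta> > 0 \<Longrightarrow> \<exists>x'. ([k], [l]) \<in> Eset b \<gamma> 1 x' \<epsilon> \<delta>"
proof -
  obtain N x k' L' where *: "e b \<gamma> 1 = real N" "k' \<in> words b 1" "L' \<subseteq> words b 1" "card L' = N"
    "\<And>l \<eta> \<epsilon> \<delta>. l \<in> L' \<Longrightarrow> \<eta> > 0 \<Longrightarrow> \<epsilon> > 0 \<Longrightarrow> \<delta> > 0 \<Longrightarrow>
       \<exists>x'. \<bar>x' - x\<bar> < \<eta> \<and> (k', l) \<in> Eset b \<gamma> 1 x' \<epsilon> \<delta>"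
    using e_limit_point[OF b] by metis
  from *(2) obtain k where k: "k < b" "k' = [k]" by (auto simp: words_1)
  from *(3) obtain L where L: "L \<subseteq> {..<b}" "L' = (\<lambda>l. [l]) ` L"
    by (auto simp: words_1 subset_image_iff)
  have b1: "b \<ge> 1" using b by simp
  have cont: "isCont (\<lambda>x. \<bar>sin (theta b x k) - sin (theta b x l)\<bar>) x"
    "isCont (\<lambda>x. \<bar>cos (theta b x k) - cos (theta b x l)\<bar>) x" for l
    unfolding theta_def using b by (auto intro!: continuous_intros)
  show thesis
  proof (rule that)
    show "e b \<gamma> 1 = real N" "k < b" "L \<subseteq> {..<b}" by fact+
    show "card L = N" using *(4) unfolding L(2) by (simp add: card_image inj_on_def)
    fix l assume l: "l \<in> L"
    have E: "\<exists>x'. \<bar>x' - x\<bar> < \<eta> \<and> ([k], [l]) \<in> Eset b \<gamma> 1 x' \<epsilon> \<delta>" if "\<eta> > 0" "\<epsilon> > 0" "\<delta> > 0" for \<eta> \<epsilon> \<delta>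
      using *(5)[of "[l]"] that l k L by auto
    show "\<bar>sin (theta b x k) - sin (theta b x l)\<bar> \<le> 2 * \<gamma> / (1 - \<gamma>)"
    proof (rule isCont_limit_le[OF cont(1)])
      fix \<eta> \<epsilon> :: real assume "\<eta> > 0" "\<epsilon> > 0"
      then obtain x' where x': "\<bar>x' - x\<bar> < \<eta>" "([k], [l]) \<in> Eset b \<gamma> 1 x' \<epsilon> 1"
        using E[of \<eta> \<epsilon> 1] by auto
      show "\<exists>x'. \<bar>x' - x\<bar> < \<eta> \<and> \<bar>sin (theta b x' k) - sin (theta b x' l)\<bar> \<le> 2 * \<gamma> / (1 - \<gamma>) + \<epsilon>"
        using x'(1) Eset_1_sin_cos(1)[OF b1 g x'(2)] by blast
    qed
    show "\<bar>cos (theta b x k) - cos (theta b x l)\<bar> \<le> 2 * \<gamma> / (real b - \<gamma>)"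
    proof (rule isCont_limit_le[OF cont(2)])
      fix \<eta> \<epsilon> :: real assume "\<eta> > 0" "\<epsilon> > 0"
      \<comment> \<open>The choice \<open>\<delta> = \<epsilon> / b\<close> makes the error
        \<open>b * \<delta>\<close> equal to \<open>\<epsilon>\<close>.\<close>
      hence "\<exists>x'. \<bar>x' - x\<bar> < \<eta> \<and> ([k], [l]) \<in> Eset b \<gamma> 1 x' \<epsilon> (\<epsilon> / real b)"
        using b by (intro E) auto
      then obtain x' where x': "\<bar>x' - x\<bar> < \<eta>" "([k], [l]) \<in> Eset b \<gamma> 1 x' \<epsilon> (\<epsilon> / real b)" by blast
      show "\<exists>x'. \<bar>x' - x\<bar> < \<eta> \<and> \<bar>cos (theta b x' k) - cos (theta b x' l)\<bar> \<le> 2 * \<gamma> / (real b - \<gamma>) + \<epsilon>"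
        using x'(1) Eset_1_sin_cos(2)[OF b1 g x'(2)] b by auto
    qed
    show "\<exists>x'. ([k], [l]) \<in> Eset b \<gamma> 1 x' \<epsilon> \<delta>" if "\<epsilon> > 0" "\<delta> > 0" for \<epsilon> \<delta>
      using E[of 1] that by auto
  qed
qed

subsection \<open>Order one\<close>

text \<open>The half sums for \<open>(k, l)\<close> and \<open>(k, m)\<close> differ by a nonzero
  number of grid steps, so the moduli of their sines add up to at least \<open>sin (pi / b)\<close>,
  while \<open>sin_mid_le\<close> makes both small.\<close>

lemma two_neighbours_bound:
  assumes b: "b \<ge> 2" and kl: "k < b" "l < b" "m < b" "k \<noteq> l" "k \<noteq> m" "l \<noteq> m"
    and "\<bar>cos (theta b x k) - cos (theta b x l)\<bar> \<le> 2 * c"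
    and "\<bar>cos (theta b x k) - cos (theta b x m)\<bar> \<le> 2 * c"
  shows "(sin (pi / real b))\<^sup>2 \<le> 2 * c"
proof -
  let ?s = "sin (pi / real b)"
  let ?y = "\<lambda>l. pi * (2 * x + real k + real l) / real b"
  have s: "?s > 0" using b by (intro sin_gt_zero) (auto simp: field_simps)
  have "?y l - ?y m = pi * of_int (int l - int m) / real b"
    using b by (simp add: field_simps)
  moreover have "?s \<le> \<bar>sin (pi * of_int (int l - int m) / real b)\<bar>"
    by (rule abs_sin_grid_ge) (use b kl in auto)
  ultimately have "?s \<le> \<bar>sin (?y l)\<bar> + \<bar>sin (?y m)\<bar>"
    using abs_sin_diff_le[of "?y l" "?y m"] by simp
  hence "?s * ?s \<le> (\<bar>sin (?y l)\<bar> + \<bar>sin (?y m)\<bar>) * ?s"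
    using s by (intro mult_right_mono) auto
  moreover have "\<bar>sin (?y l)\<bar> * ?s \<le> c" "\<bar>sin (?y m)\<bar> * ?s \<le> c"
    by (rule sin_mid_le; use assms in simp)+
  ultimately show ?thesis by (simp add: power2_eq_square distrib_right)
qed

text \<open>All half sums have small sine by \<open>sin_mid_le\<close>;
  \<open>card_sin_small\<close> counts such points on the grid of mesh
  \<open>pi / b\<close>.\<close>

lemma neighbours_card_bound:
  assumes b: "b \<ge> 2" and k: "k < b" "L \<subseteq> {..<b}" "k \<notin> L" "L \<noteq> {}"
    and cos: "\<And>l. l \<in> L \<Longrightarrow> \<bar>cos (theta b x k) - cos (theta b x l)\<bar> \<le> 2 * c"
  shows "(real (card L) - 1) * sin (pi / real b) \<le> real b * c"
proof -
  let ?s = "sin (pi / real b)"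
  have s: "?s > 0" using b by (intro sin_gt_zero) (auto simp: field_simps)
  have "real (card L) - 1 \<le> real b * (c / ?s)"
  proof (rule card_sin_small[of _ _ "2 * x + real k"])
    fix l assume l: "l \<in> L"
    have "\<bar>sin (pi * (2 * x + real k + real l) / real b)\<bar> * ?s \<le> c"
      by (rule sin_mid_le[OF b k(1) _ _ cos[OF l]]) (use l k in auto)
    thus "\<bar>sin (pi * (2 * x + real k + real l) / real b)\<bar> \<le> c / ?s"
      using s by (simp add: pos_le_divide_eq)
  qed (use assms in auto)
  thus ?thesis using s by (simp add: pos_le_divide_eq)
qed

section \<open>Order one for \<open>b \<ge> 4\<close>\<close>

text \<open>The chord to \<open>pi / 4\<close>, with
  \<open>4 * sin (pi / 4) = 2 * sqrt 2 > 2.8\<close>.\<close>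

lemma sin_pi_div_ge_4:
  assumes "b \<ge> 4"
  shows "2.8 / real b \<le> sin (pi / real b)"
proof -
  have "4 / real b * sin (pi / 4) \<le> sin (4 / real b * (pi / 4))"
    by (rule sin_scale_ge) (use assms in auto)
  moreover have "sqrt 2 \<ge> 1.4" by (rule real_le_rsqrt) (simp add: power2_eq_square)
  hence "2.8 / real b \<le> 4 / real b * sin (pi / 4)"
    using assms by (simp add: sin_45 field_simps)
  ultimately show ?thesis by simp
qed

lemma sin_pi_div_ge_6:
  assumes "b \<ge> 6"
  shows "3 / real b \<le> sin (pi / real b)"
proof -
  have "6 / real b * sin (pi / 6) \<le> sin (6 / real b * (pi / 6))"
    by (rule sin_scale_ge) (use assms in auto)
  thus ?thesis using assms by (simp add: sin_30)
qed

text \<open>The function \<open>t / (a - t)\<close> increases for \<open>t < a\<close>; the right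
  side is its value at \<open>t = n / B\<close>.\<close>

lemma div_diff_le:
  fixes \<gamma> B n :: real
  assumes "0 \<le> \<gamma>" "\<gamma> * B \<le> n" "n < B * a" "0 < B" "0 < a"
  shows "\<gamma> / (a - \<gamma>) \<le> n / (B * a - n)"
proof -
  have *: "\<gamma> < a"
    using assms by (smt (verit) mult.commute mult_less_cancel_left_pos)
  have "\<gamma> * (B * a - n) \<le> n * (a - \<gamma>)"
    using mult_right_mono[OF assms(2), of a] assms(5) by (simp add: algebra_simps)
  thus ?thesis
    using assms * by (simp add: divide_simps mult.commute)
qed

text \<open>If \<open>\<gamma> * b \<le> N\<close>, the cosine bound is too small for
  \<open>N\<close> partners. Counting shows this for \<open>N \<ge> 4\<close> but is too weak at
  \<open>N = 3\<close>, where two partners other than \<open>k\<close> are compared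
  directly.\<close>

lemma e_1_ge_3_imp_less:
  assumes b: "b \<ge> 4" and g: "0 < \<gamma>" "\<gamma> < 1" and e: "e b \<gamma> 1 \<ge> 3"
  shows "e b \<gamma> 1 < \<gamma> * real b"
proof (rule ccontr)
  assume neg: "\<not> e b \<gamma> 1 < \<gamma> * real b"
  have b2: "b \<ge> 2" and g0: "0 \<le> \<gamma>" using b g by auto
  obtain N x k L where L: "e b \<gamma> 1 = real N" "k < b" "L \<subseteq> {..<b}" "card L = N"
    "\<And>l. l \<in> L \<Longrightarrow> \<bar>cos (theta b x k) - cos (theta b x l)\<bar> \<le> 2 * \<gamma> / (real b - \<gamma>)"
    using e_1_limit_point[OF b2 g0 g(2)] by metis
  define c where "c = \<gamma> / (real b - \<gamma>)"
  have cos: "\<bar>cos (theta b x k) - cos (theta b x l)\<bar> \<le> 2 * c" if "l \<in> L" for l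
    using L(5)[OF that] unfolding c_def by simp
  have N: "N \<ge> 3" "\<gamma> * real b \<le> real N" using e neg L(1) by auto
  have B: "real b \<ge> 4" using b by simp
  have finL: "finite L" using L(3) finite_subset by blast
  \<comment> \<open>The digit \<open>k\<close> itself may belong to \<open>L\<close>.\<close>
  have cardL: "card (L - {k}) \<ge> N - 1" using L(4) finL by (simp add: card_Diff_singleton_if)
  note s = sin_pi_div_ge_4[OF b]
  show False
  proof (cases "N = 3")
    case True
    obtain l m where lm: "l \<in> L - {k}" "m \<in> L - {k}" "l \<noteq> m"
      using cardL True by (metis One_nat_def card_le_Suc0_iff_eq finL finite_Diff
          Suc_1 diff_Suc_1 not_less_eq_eq numeral_3_eq_3)
    have "(sin (pi / real b))\<^sup>2 \<le> 2 * c"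
      by (rule two_neighbours_bound[of b k l m x]) (use b2 lm L cos in auto)
    moreover have "(2.8 / real b)\<^sup>2 \<le> (sin (pi / real b))\<^sup>2"
      by (rule power_mono[OF s]) simp
    moreover have sq: "real b * real b \<ge> 4 * 4" using B by (intro mult_mono) auto
    have "c \<le> 3 / (real b * real b - 3)" unfolding c_def
      by (rule div_diff_le) (use g N True B sq in auto)
    ultimately have "(2.8 / real b)\<^sup>2 \<le> 6 / (real b * real b - 3)" by simp
    \<comment> \<open>This forces \<open>b^2 < 13\<close>, against \<open>b \<ge> 4\<close>.\<close>
    hence "2.8 * 2.8 * (real b * real b - 3) \<le> 6 * (real b * real b)"
      using B sq by (simp add: field_simps power2_eq_square)
    thus False using sq by simp
  next
    case False
    have n4: "real N \<ge> 4" using False N by simp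
    have "real (card (L - {k})) \<ge> real N - 1" using cardL by linarith
    hence card: "real N - 2 \<le> real (card (L - {k})) - 1" by simp
    have "L - {k} \<noteq> {}" using cardL False N by fastforce
    hence "(real (card (L - {k})) - 1) * sin (pi / real b) \<le> real b * c"
      using L(2,3) cos by (intro neighbours_card_bound[of b k _ x]) (use b2 in auto)
    moreover have "(real N - 2) * (2.8 / real b) \<le> (real (card (L - {k})) - 1) * sin (pi / real b)"
      by (rule mult_mono[OF card s]) (use card n4 in auto)
    moreover have "real b * c \<le> real N / (real b - 1)"
      unfolding c_def using N(2) g B by (auto simp: mult.commute intro!: frac_le)
    ultimately have "(real N - 2) * (2.8 / real b) \<le> real N / (real b - 1)" by linarith
    hence "(real N - 2) * 2.8 * (real b - 1) \<le> real N * real b"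
      using B by (simp add: field_simps)
    \<comment> \<open>Bounding \<open>N * b\<close> below by \<open>4 * N + 4 * b - 16\<close> makes
      the inequality linear.\<close>
    moreover have "(real N - 4) * (real b - 4) \<ge> 0" using n4 B by (intro mult_nonneg_nonneg) auto
    ultimately show False using n4 B by (simp add: algebra_simps)
  qed
qed

text \<open>The first-order terms alone allow equality when \<open>b = 6\<close> and \<open>\<gamma> = 1/3\<close>. Closeness of the
  sines then forces the second angles towards \<open>\<plusminus>\<pi>/2\<close>, hence the first ones, their sixfold
  multiples, towards multiples of \<open>\<pi>\<close>.\<close>

lemma Eset_6_imp_eq:
  assumes g: "0 \<le> \<gamma>" "\<gamma> \<le> 1/3" and kl: "k < 6" "l < 6"
    and E: "([k], [l]) \<in> Eset 6 \<gamma> 1 x (1/1000) (1/1000)"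
  shows "k = l"
proof (rule ccontr)
  assume neq: "k \<noteq> l"
  from E obtain u v where t: "tangent 6 \<gamma> (1/1000) (1/1000) x (concat_seq [k] u) (concat_seq [l] v)"
    unfolding Eset_def by auto
  define a where "a = theta 6 x k"
  define a' where "a' = theta 6 x l"
  define d where "d = angle 6 x (concat_seq [k] u) 1"
  define d' where "d' = angle 6 x (concat_seq [l] v) 1"
  define A where "A = \<bar>sin a - sin a'\<bar>"
  define B where "B = \<bar>cos a - cos a'\<bar>"
  \<comment> \<open>\<open>C\<close> measures how far the second angles are from odd multiples of
    \<open>pi / 2\<close>.\<close>
  define C where "C = \<bar>cos d\<bar> + \<bar>cos d'\<bar>"
  have g1: "\<gamma> < 1" using g by simp
  have C2: "0 \<le> C" "C \<le> 2" unfolding C_def using abs_cos_le_one[of d] abs_cos_le_one[of d'] by linarith+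
  have "6 * d = a + 2 * real (u 0) * pi" "6 * d' = a' + 2 * real (v 0) * pi"
    unfolding d_def d'_def a_def a'_def using angle_1[of 6] by simp_all
  hence "sin (6 * d) = sin a" "sin (6 * d') = sin a'"
    by (simp_all only: sin_add sin_2npi cos_2npi mult_1_right mult_zero_right add_0_right)
  hence A6: "A \<le> 6 * C"
    using abs_sin_even_mult_le[of 3 d] abs_sin_even_mult_le[of 3 d'] unfolding A_def C_def by simp
  have half: "1/2 \<le> \<bar>sin ((a - a') / 2)\<bar>"
    using grid_sin_ge[of 6 k l x] neq kl unfolding a_def a'_def by (simp add: sin_30)
  have "(1/2)\<^sup>2 \<le> (sin ((a - a') / 2))\<^sup>2"
    using power_mono[OF half, of 2] by simp
  hence AB: "1 \<le> A\<^sup>2 + B\<^sup>2"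
    using sin_cos_diff_sq[of a a'] unfolding A_def B_def by (simp add: power2_eq_square)
  \<comment> \<open>Both tails are largest at \<open>\<gamma> = 1/3\<close>: 1/3 for the sines and,
    further down, 1/153 for the cosines.\<close>
  have "\<gamma> * \<gamma> \<le> 1/3 * (1/3)" using g by (intro mult_mono) auto
  hence "2 * \<gamma>\<^sup>2 / (1 - \<gamma>) \<le> 1/3" using g by (simp add: pos_divide_le_eq power2_eq_square)
  moreover have "\<bar>(sin a - sin a') + \<gamma> * (sin d - sin d')\<bar> \<le> 2 * \<gamma>\<^sup>2 / (1 - \<gamma>) + 1/1000"
    using tangent_sin[OF g(1) g1 t, of 2]
    by (simp add: numeral_2_eq_2 angle_0 a_def a'_def d_def d'_def)
  ultimately have 1: "A \<le> 1/3 + 1/1000 + \<bar>\<gamma> * (sin d - sin d')\<bar>" unfolding A_def by linarith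
  have "\<bar>\<gamma> * (sin d - sin d')\<bar> = \<gamma> * \<bar>sin d - sin d'\<bar>" using g by (simp add: abs_mult)
  also have "\<dots> \<le> 1/3 * \<bar>sin d - sin d'\<bar>" using g by (intro mult_right_mono) auto
  also have "\<dots> \<le> 1/3 * (2 - ((cos d)\<^sup>2 + (cos d')\<^sup>2) / 2)"
  proof -
    have "\<bar>sin d - sin d'\<bar> \<le> 2 - ((cos d)\<^sup>2 + (cos d')\<^sup>2) / 2"
      using abs_sin_le_cos_sq[of d] abs_sin_le_cos_sq[of d'] abs_triangle_ineq4[of "sin d" "sin d'"]
      by (simp add: add_divide_distrib)
    thus ?thesis by simp
  qed
  finally have "A \<le> 1 + 1/1000 - ((cos d)\<^sup>2 + (cos d')\<^sup>2) / 6" using 1 by simp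
  moreover have "C\<^sup>2 \<le> 2 * ((cos d)\<^sup>2 + (cos d')\<^sup>2)"
  proof -
    have "0 \<le> (\<bar>cos d\<bar> - \<bar>cos d'\<bar>)\<^sup>2" by simp
    thus ?thesis unfolding C_def by (simp add: power2_diff power2_sum)
  qed
  ultimately have AC: "A \<le> 1 + 1/1000 - C\<^sup>2 / 12" by (simp add: add_divide_distrib)
  have "2 * (\<gamma>/6)\<^sup>2 / (1 - \<gamma>/6) \<le> 1/153"
    using \<open>\<gamma> * \<gamma> \<le> 1/3 * (1/3)\<close> g by (simp add: pos_divide_le_eq power2_eq_square)
  moreover have "\<bar>(cos a - cos a') + \<gamma>/6 * (cos d - cos d')\<bar> \<le> 2 * (\<gamma>/6)\<^sup>2 / (1 - \<gamma>/6) + 6/1000"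
    using tangent_cos[OF _ g(1) g1 t, of 2]
    by (simp add: numeral_2_eq_2 angle_0 a_def a'_def d_def d'_def)
  ultimately have 2: "B \<le> 1/153 + 6/1000 + \<bar>\<gamma>/6 * (cos d - cos d')\<bar>" unfolding B_def by linarith
  have "\<bar>\<gamma>/6 * (cos d - cos d')\<bar> = \<gamma>/6 * \<bar>cos d - cos d'\<bar>" using g by (simp add: abs_mult)
  also have "\<dots> \<le> 1/18 * \<bar>cos d - cos d'\<bar>" using g by (intro mult_right_mono) auto
  also have "\<dots> \<le> 1/18 * C" unfolding C_def
    using abs_triangle_ineq4[of "cos d" "cos d'"] by simp
  finally have BC: "B \<le> C/18 + 0.0126" using 2 by simp
  have B0: "B \<ge> 0" "A \<ge> 0" unfolding A_def B_def by auto
  \<comment> \<open>For \<open>A \<ge> 1\<close> the claim \<open>1 - B\<^sup>2 \<le> A\<close> is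
    trivial; otherwise \<open>A\<^sup>2 \<le> A\<close>.\<close>
  have "A\<^sup>2 \<le> A \<or> 1 \<le> A" using B0 by (cases "A \<le> 1") (auto simp: power2_eq_square mult_left_le)
  hence A1: "1 - B\<^sup>2 \<le> A" using AB by (smt (verit) zero_le_power2)
  \<comment> \<open>Now \<open>A \<ge> 0.96\<close>, so \<open>A \<le> 6 * C\<close> keeps
    \<open>C\<close> away from 0, whereas \<open>AC\<close> makes \<open>C\<close> small.\<close>
  have "B\<^sup>2 \<le> 0.2\<^sup>2" by (rule power_mono) (use BC C2 B0 in auto)
  hence C16: "0.16 \<le> C" using A1 A6 by (simp add: power2_eq_square)
  have "B\<^sup>2 \<le> (C/18 + 0.0126)\<^sup>2" by (rule power_mono[OF BC B0(1)])
  hence "C * C \<le> 0.012 + 12 * (C/18 + 0.0126)\<^sup>2" using A1 AC by (simp add: power2_eq_square)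
  \<comment> \<open>The term \<open>C * C / 27\<close> has moved to the left; the quadratic
    inequality fails for \<open>C \<ge> 0.16\<close>.\<close>
  hence "26/27 * (C * C) \<le> 0.0168 * C + 0.014" by (simp add: power2_eq_square algebra_simps)
  thus False using zero_le_square[of "C - 0.16"] C16 by (simp add: algebra_simps)
qed

text \<open>For \<open>b \<ge> 7\<close> the chord identity suffices: scaled by \<open>b\<close>,
  the chord is at least 6, but its two coordinates allow less. At \<open>b = 6\<close> the sine
  bound alone reaches 6, and \<open>Eset_6_imp_eq\<close> is used.\<close>

lemma e_1_eq_2_imp_less:
  assumes b: "b \<ge> 6" and g: "0 < \<gamma>" "\<gamma> < 1" and e: "e b \<gamma> 1 = 2"
  shows "2 < \<gamma> * real b"
proof (rule ccontr)
  assume neg: "\<not> 2 < \<gamma> * real b"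
  have b2: "b \<ge> 2" and g0: "0 \<le> \<gamma>" using b g by auto
  obtain N x k L where L: "e b \<gamma> 1 = real N" "k < b" "L \<subseteq> {..<b}" "card L = N"
    "\<And>l. l \<in> L \<Longrightarrow> \<bar>sin (theta b x k) - sin (theta b x l)\<bar> \<le> 2 * \<gamma> / (1 - \<gamma>)"
    "\<And>l. l \<in> L \<Longrightarrow> \<bar>cos (theta b x k) - cos (theta b x l)\<bar> \<le> 2 * \<gamma> / (real b - \<gamma>)"
    "\<And>l \<epsilon> \<delta>. l \<in> L \<Longrightarrow> \<epsilon> > 0 \<Longrightarrow> \<delta> > 0 \<Longrightarrow> \<exists>x'. ([k], [l]) \<in> Eset b \<gamma> 1 x' \<epsilon> \<delta>"
    using e_1_limit_point[OF b2 g0 g(2)] by metis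
  have "card L = 2" using L(1,4) e by simp
  then obtain l where l: "l \<in> L" "l \<noteq> k"
    by (metis card_2_iff insertCI)
  have lb: "l < b" using l(1) L(3) by auto
  show False
  proof (cases "b = 6")
    case True
    obtain x' where "([k], [l]) \<in> Eset 6 \<gamma> 1 x' (1/1000) (1/1000)"
      using L(7)[OF l(1), of "1/1000" "1/1000"] True by auto
    hence "k = l" by (rule Eset_6_imp_eq[rotated -1]) (use g neg True L(2) lb in auto)
    thus False using l(2) by simp
  next
    case False
    hence B: "real b \<ge> 7" using b by simp
    have bb: "real b * real b \<ge> 7 * real b" using B by (intro mult_right_mono) auto
    hence bb2: "2 < real b * real b" using B by linarith
    have 1: "\<gamma> / (1 - \<gamma>) \<le> 2 / (real b * 1 - 2)"
      by (rule div_diff_le) (use g neg B in auto)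
    have 2: "\<gamma> / (real b - \<gamma>) \<le> 2 / (real b * real b - 2)"
      by (rule div_diff_le) (use g neg B bb2 in auto)
    let ?s = "sin ((theta b x k - theta b x l) / 2)"
    \<comment> \<open>Here \<open>14/5\<close>, and below \<open>14/47\<close>, are values at
      \<open>b = 7\<close> of functions decreasing in \<open>b\<close>.\<close>
    have "real b * (2 / (real b * 1 - 2)) \<le> 14/5" using B by (simp add: divide_simps)
    hence A: "real b * \<bar>sin (theta b x k) - sin (theta b x l)\<bar> \<le> 28/5"
      using mult_left_mono[OF order_trans[OF L(5)[OF l(1)]], of "2 * (2 / (real b * 1 - 2))" "real b"] 1 B
      by simp
    have "real b * (2 / (real b * real b - 2)) \<le> 14/47"
    proof -
      have "47 * (real b * 2) \<le> 14 * (real b * real b - 2)"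
        using zero_le_square[of "real b - 7"] B by (simp add: algebra_simps)
      thus ?thesis using bb2 by (simp add: divide_simps)
    qed
    hence C: "real b * \<bar>cos (theta b x k) - cos (theta b x l)\<bar> \<le> 28/47"
      using mult_left_mono[OF order_trans[OF L(6)[OF l(1)]], of "2 * (2 / (real b * real b - 2))" "real b"] 2 B
      by simp
    have "3 / real b \<le> \<bar>?s\<bar>"
      using sin_pi_div_ge_6[OF b] grid_sin_ge[OF b2 L(2) lb, of x] l(2) by simp
    hence "3 \<le> real b * \<bar>?s\<bar>" using B by (simp add: field_simps)
    hence "3\<^sup>2 \<le> (real b * \<bar>?s\<bar>)\<^sup>2" by (rule power_mono) simp
    hence "36 \<le> (real b)\<^sup>2 * (4 * ?s\<^sup>2)" by (simp add: power_mult_distrib)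
    also have "\<dots> = (real b * \<bar>sin (theta b x k) - sin (theta b x l)\<bar>)\<^sup>2
        + (real b * \<bar>cos (theta b x k) - cos (theta b x l)\<bar>)\<^sup>2"
      unfolding sin_cos_diff_sq[symmetric] by (simp add: power_mult_distrib distrib_left)
    \<comment> \<open>The right side is below 32.\<close>
    also have "\<dots> \<le> (28/5)\<^sup>2 + (28/47)\<^sup>2" by (intro add_mono power_mono A C) auto
    finally show False by (simp add: power2_eq_square)
  qed
qed

section \<open>The case \<open>b = 3\<close>\<close>

lemma sin_ge_middle_third:
  assumes "pi / 3 \<le> t" "t \<le> 2 * pi / 3"
  shows "sqrt 3 / 2 \<le> sin t"
proof -
  have *: "sqrt 3 / 2 \<le> sin s" if "pi / 3 \<le> s" "s \<le> pi / 2" for s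
    unfolding sin_60[symmetric] by (rule sin_monotone_2pi_le) (use that pi_gt_zero in linarith)+
  show ?thesis
  proof (cases "t \<le> pi / 2")
    case False
    thus ?thesis using *[of "pi - t"] assms by simp
  qed (use * assms in auto)
qed

text \<open>For \<open>b = 3\<close> at least one of the three pairs of digits is not tangent over each half of
  \<open>[0,1)\<close>, so tangency is confined to a star. With weight \<open>1/\<surd>2\<close> out of and \<open>\<surd>2\<close> into the centre,
  all row sums become \<open>1 + \<surd>2\<close>.\<close>

definition centre3 :: "real \<Rightarrow> nat" where
  "centre3 x = (if x < 1/2 then 2 else 0)"

definition V3 :: "real \<Rightarrow> nat list \<Rightarrow> nat list \<Rightarrow> real" where
  "V3 x u v = (if u = v then 1 else if u = [centre3 x] then 1 / sqrt 2
     else if v = [centre3 x] then sqrt 2 else 0)"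

text \<open>A pair avoiding the centre has digit sum 1 or 3, according to the half of
  \<open>[0,1)\<close>, so its half sum lies in \<open>[pi/3, 2*pi/3]\<close> modulo
  \<open>pi\<close>. Both sine factors are then at least \<open>sqrt 3 / 2\<close> and the cosines
  differ by at least \<open>3/2\<close>, whereas tangency with \<open>\<delta> = 1/6\<close> allows
  less.\<close>

lemma Eset_3_centre:
  assumes g: "0 \<le> \<gamma>" "\<gamma> < 1" and x: "x \<in> {0..<1}" and kl: "k < 3" "l < 3" "k \<noteq> l"
    and E: "([k], [l]) \<in> Eset 3 \<gamma> 1 x 1 (1/6)"
  shows "k = centre3 x \<or> l = centre3 x"
proof (rule ccontr)
  assume "\<not> ?thesis"
  hence kl': "if x < 1/2 then k + l = 1 else k + l = 3"
    using kl unfolding centre3_def by (cases "x < 1/2") auto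
  let ?m = "sin ((theta 3 x k + theta 3 x l) / 2)"
  have m: "sqrt 3 / 2 \<le> \<bar>?m\<bar>"
  proof (cases "x < 1/2")
    case True
    hence "real k + real l = 1" using kl' by simp
    hence eq: "(theta 3 x k + theta 3 x l) / 2 = pi * (2 * x + 1) / 3"
      unfolding theta_sum_half by (simp add: add.assoc)
    have "sqrt 3 / 2 \<le> sin (pi * (2 * x + 1) / 3)"
      by (rule sin_ge_middle_third) (use True x in auto)
    thus ?thesis unfolding eq by simp
  next
    case False
    hence "real k + real l = 3" using kl' by simp
    hence *: "2 * x + real k + real l = 2 * x + 3" by simp
    have eq: "(theta 3 x k + theta 3 x l) / 2 = pi * (2 * x) / 3 + pi"
      unfolding theta_sum_half * by (simp add: field_simps)
    have "sqrt 3 / 2 \<le> sin (pi * (2 * x) / 3)"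
      by (rule sin_ge_middle_third) (use False x in auto)
    thus ?thesis unfolding eq by simp
  qed
  moreover have "sqrt 3 / 2 \<le> \<bar>sin ((theta 3 x k - theta 3 x l) / 2)\<bar>"
    using grid_sin_ge[of 3 k l x] kl by (simp add: sin_60)
  ultimately have "sqrt 3 / 2 * (sqrt 3 / 2) \<le> \<bar>?m\<bar> * \<bar>sin ((theta 3 x k - theta 3 x l) / 2)\<bar>"
    by (intro mult_mono) auto
  hence "3/2 \<le> \<bar>cos (theta 3 x k) - cos (theta 3 x l)\<bar>" unfolding abs_cos_diff by simp
  also have "\<dots> \<le> 2 * \<gamma> / (3 - \<gamma>) + 1/2"
    using Eset_1_sin_cos(2)[OF _ g E] by simp
  also have "\<dots> < 3/2" using g by (simp add: divide_simps)
  finally show False by simp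
qed

text \<open>On an edge of the star the values \<open>1 / sqrt 2\<close> and \<open>sqrt 2\<close>
  multiply to 1, as admissibility asks.\<close>

lemma sigma_3_le:
  assumes g: "0 \<le> \<gamma>" "\<gamma> < 1"
  shows "sigma 3 \<gamma> 1 \<le> ereal (1 + sqrt 2)"
proof (rule sigma_le)
  have "{..<3::nat} = {0, 1, 2}" by auto
  hence words3: "words 3 1 = {[0], [1], [2]}" unfolding One_nat_def words_1 by simp
  show "admissible 3 \<gamma> 1 V3" unfolding admissible_def
  proof (intro conjI ballI)
    fix u v
    have "(\<lambda>x. V3 x u v) = (\<lambda>x. if x < 1/2 then V3 0 u v else V3 1 u v)"
      by (simp add: fun_eq_iff V3_def centre3_def)
    hence "(\<lambda>x. V3 x u v) \<in> borel_measurable borel" by simp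
    thus "(\<lambda>x. V3 x u v) \<in> borel_measurable (restrict_space lebesgue {0..<1})"
      by (intro measurable_restrict_space1) (simp add: measurable_completion)
    show "V3 x u v \<ge> 0" for x unfolding V3_def by simp
  next
    have "V3 x u v * V3 x v u \<ge> 1" if x: "x \<in> {0..<1}" and E: "(u, v) \<in> Eset 3 \<gamma> 1 x 1 (1/6)" for x u v
    proof -
      obtain k l where kl: "k < 3" "l < 3" "u = [k]" "v = [l]"
        using subsetD[OF Eset_subset_words E] by (auto simp: words_1)
      show ?thesis
      proof (cases "k = l")
        case False
        thus ?thesis using Eset_3_centre[OF g x kl(1,2) False] E unfolding V3_def kl by auto
      qed (simp add: V3_def kl)
    qed
    thus "\<exists>\<epsilon>>0. \<exists>\<delta>>0. \<forall>x\<in>{0..<1}. \<forall>u v. (u, v) \<in> Eset 3 \<gamma> 1 x \<epsilon> \<delta> \<longrightarrow> V3 x u v * V3 x v u \<ge> 1"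
      by (intro exI[of _ 1] conjI exI[of _ "1/6"]) auto
  qed
  \<comment> \<open>The row of the centre is \<open>1 + 2 / sqrt 2\<close>, every other row
    \<open>1 + sqrt 2 + 0\<close>.\<close>
  have "2 / sqrt 2 = sqrt 2" by (simp add: real_div_sqrt)
  hence sum: "(\<Sum>v\<in>words 3 1. V3 x u v) = 1 + sqrt 2" if "u \<in> words 3 1" for x u
    using that unfolding words3 V3_def centre3_def by (cases "x < 1/2") auto
  have "(\<lambda>u. \<Sum>v\<in>words 3 1. V3 x u v) ` words 3 1 = (\<lambda>_. 1 + sqrt 2) ` words 3 1" for x
    by (rule image_cong[OF refl sum])
  hence "(\<lambda>u. \<Sum>v\<in>words 3 1. V3 x u v) ` words 3 1 = {1 + sqrt 2}" for x
    using words3 by (simp only: image_insert image_empty insert_absorb2)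
  hence "SigmaVw 3 1 V3 (\<lambda>_. 1) x = 1 + sqrt 2" for x
    unfolding SigmaVw_def by (simp only: div_by_1 mult_1_left Max_singleton)
  hence eq: "SigmaVw 3 1 V3 (\<lambda>_. 1) = (\<lambda>_. 1 + sqrt 2)" by auto
  show "SigmaVw 3 1 V3 (\<lambda>_. 1) \<in> borel_measurable (restrict_space lebesgue {0..<1})"
    "\<bar>SigmaVw 3 1 V3 (\<lambda>_. 1) x\<bar> \<le> 1 + sqrt 2" for x
    unfolding eq by auto
qed

text \<open>If \<open>3 * \<gamma>\<close> exceeds \<open>1 + sqrt 2\<close>, the star function
  suffices. Otherwise \<open>N = 3\<close> is impossible, since it would need
  \<open>3 * \<gamma> \<ge> 27/11 > 1 + sqrt 2\<close>; with 2 excluded, \<open>e\<close> is at most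
  1 and \<open>sigma_le_e\<close> applies.\<close>

lemma sigma_3_less:
  assumes g: "1/3 < \<gamma>" "\<gamma> < 1" and e: "e 3 \<gamma> 1 \<noteq> 2"
  shows "sigma 3 \<gamma> 1 < ereal (3 * \<gamma>)"
proof (cases "1 + sqrt 2 < 3 * \<gamma>")
  case True
  have "sigma 3 \<gamma> 1 \<le> ereal (1 + sqrt 2)" by (rule sigma_3_le) (use g in auto)
  also have "\<dots> < ereal (3 * \<gamma>)" using True by simp
  finally show ?thesis .
next
  case False
  have g0: "0 \<le> \<gamma>" using g by simp
  obtain N x k L where L: "e 3 \<gamma> 1 = real N" "k < 3" "L \<subseteq> {..<3}" "card L = N"
    "\<And>l. l \<in> L \<Longrightarrow> \<bar>cos (theta 3 x k) - cos (theta 3 x l)\<bar> \<le> 2 * \<gamma> / (real 3 - \<gamma>)"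
    using e_1_limit_point[of 3 \<gamma>] g0 g by (metis numeral_2_eq_2 numeral_3_eq_3 lessI less_imp_le)
  have "N \<noteq> 3"
  proof
    assume "N = 3"
    hence "L = {..<3}" using L(3,4) by (intro card_subset_eq) auto
    moreover obtain l m where "l < 3" "m < 3" "l \<noteq> k" "m \<noteq> k" "l \<noteq> m"
    proof -
      have "k = 0 \<or> k = 1 \<or> k = 2" using L(2) by auto
      thus thesis using that[of 0 1] that[of 0 2] that[of 1 2] by auto
    qed
    ultimately have "(sin (pi / real 3))\<^sup>2 \<le> 2 * (\<gamma> / (3 - \<gamma>))"
      using L by (intro two_neighbours_bound[of 3 k l m x]) auto
    hence "3/4 \<le> 2 * (\<gamma> / (3 - \<gamma>))" by (simp add: sin_60 power_divide)
    hence "27/11 \<le> 3 * \<gamma>" using g by (simp add: field_simps)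
    moreover have "sqrt 2 < 16/11" by (rule real_less_lsqrt) (auto simp: power2_eq_square)
    ultimately show False using False by simp
  qed
  moreover have "N \<le> 3" using L(3,4) card_mono[of "{..<3::nat}" L] by auto
  moreover have "N \<noteq> 2" using e L(1) by auto
  ultimately have "N \<le> 1" by simp
  have "sigma 3 \<gamma> 1 \<le> ereal (e 3 \<gamma> 1)" by (rule sigma_le_e) simp
  also have "\<dots> < ereal (3 * \<gamma>)" using \<open>N \<le> 1\<close> L(1) g by simp
  finally show ?thesis .
qed

theorem theorem3p1:
  fixes b :: nat and \<gamma> :: real
  assumes "b \<ge> 2" and "1 / real b < \<gamma>" and "\<gamma> < 1"
  shows "(b \<ge> 6 \<longrightarrow> sigma b \<gamma> 1 \<le> ereal (e b \<gamma> 1) \<and> e b \<gamma> 1 < \<gamma> * real b)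
       \<and> (b \<in> {4, 5} \<longrightarrow> e b \<gamma> 1 = 2 \<or> e b \<gamma> 1 < \<gamma> * real b)
       \<and> (b = 3 \<longrightarrow> e b \<gamma> 1 = 2 \<or> sigma b \<gamma> 1 < ereal (\<gamma> * real b))"
proof -
  have gb: "1 < \<gamma> * real b" using assms(1,2) by (simp add: field_simps)
  have g: "0 < \<gamma>" using assms(2) by (smt (verit) divide_nonneg_nonneg of_nat_0_le_iff)
  obtain P where "e b \<gamma> 1 = real (e_level b \<gamma> 1 P)"
    using e_eq_e_level[of b \<gamma> 1] assms(1) by auto
  \<comment> \<open>As \<open>e\<close> is a natural number, these cases are exhaustive; the first
    is settled by \<open>1 < \<gamma> * b\<close>.\<close>
  then consider "e b \<gamma> 1 \<le> 1" | "e b \<gamma> 1 = 2" | "e b \<gamma> 1 \<ge> 3" by fastforce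
  hence less: "e b \<gamma> 1 = 2 \<and> b < 6 \<or> e b \<gamma> 1 < \<gamma> * real b" if "b \<ge> 4"
  proof cases
    case 2
    thus ?thesis using e_1_eq_2_imp_less[of b, OF _ g assms(3)] by (cases "b < 6") auto
  qed (use gb e_1_ge_3_imp_less[OF that g assms(3)] in auto)
  have "e b \<gamma> 1 = 2 \<or> sigma b \<gamma> 1 < ereal (\<gamma> * real b)" if "b = 3"
    using sigma_3_less[of \<gamma>] assms(2,3) unfolding that by (auto simp: mult.commute)
  thus ?thesis
    using less sigma_le_e[OF assms(1), of \<gamma> 1] by auto
qed

end
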